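(* Let $S$ be an inverse semigroup. Then $G_u(S^{\mathrm{Clif}})$ is isomorphic (as an étale topological groupoid) to $G_u(S)_{\mathrm{fix}}$.
   Context: An inverse semigroup is a semigroup $S$ in which every $s$ has a unique $s^*$ with $s=ss^*s$, $s^*=s^*ss^*$. $E(S)$ is the (commutative) semigroup of idempotents. $\widehat{E(S)}$ is the set of nonzero semigroup homomorphisms $E(S)\to\{0,1\}$ with the topology of pointwise convergence. For $e\in E(S)$ let $D_e=\{\xi\in\widehat{E(S)}:\xi(e)=1\}$; for $s\in S$ and $\xi\in D_{s^*s}$ let $\beta_s(\xi)\in D_{ss^*}$ be $\beta_s(\xi)(e)=\xi(s^*es)$. A character $\xi\in\widehat{E(S)}$ is fixed if $\xi(s^*es)=\xi(e)$ for all $e\in E(S)$ and all $s\in S$ with $\xi(s^*s)=1$; $\widehat{E(S)}_{\mathrm{fix}}$ is the set of fixed characters. Let $\rho_{\mathrm{Clif}}$ be the congruence on $E(S)$ consisting of all $(e,f)$ with $\xi(e)=\xi(f)$ for all $\xi\in\widehat{E(S)}_{\mathrm{fix}}$. Let $\nu_{\mathrm{Clif}}$ be the congruence on $S$ given by: $(s,t)\in\nu_{\mathrm{Clif}}$ iff $(s^*s,t^*t)\in\rho_{\mathrm{Clif}}$ and $se=te$ for some $e\in E(S)$ with $(e,s^*s)\in\rho_{\mathrm{Clif}}$. Put $S^{\mathrm{Clif}}=S/\nu_{\mathrm{Clif}}$, an inverse semigroup. Universal groupoid $G_u(S)$: the set of classes $[s,\xi]$ of pairs $(s,\xi)\in S\times\widehat{E(S)}$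 with $\xi(s^*s)=1$, where $(s,\xi)\sim(t,\eta)$ iff $\xi=\eta$ and there is $e\in E(S)$ with $\xi(e)=1$ and $se=te$. The unit space is $\widehat{E(S)}$ (via $\xi\mapsto[e,\xi]$ for any $e$ with $\xi(e)=1$), $d([s,\xi])=\xi$, $r([s,\xi])=\beta_s(\xi)$, $[s,\beta_t(\xi)][t,\xi]=[st,\xi]$, $[s,\xi]^{-1}=[s^*,\beta_s(\xi)]$. The sets $\{[s,\xi]:\xi\in U\}$, with $s\in S$ and $U\subset D_{s^*s}$ open, form a basis of the topology; $G_u(S)$ is an étale groupoid. For an étale groupoid $G$, a unit $x\in G^{(0)}$ is a fixed point if $d(\alpha)=x$ implies $r(\alpha)=x$; $G_{\mathrm{fix}}=d^{-1}(F)$ with the relative topology, where $F$ is the set of all fixed points. *)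

theory Defs
  imports "HOL-Analysis.Analysis"
begin

record 'a sgrp =
  carrier :: "'a set"
  mult :: "'a \<Rightarrow> 'a \<Rightarrow> 'a"  (infixl "\<cdot>\<index>" 70)

definition inverse_semigroup :: "'a sgrp \<Rightarrow> bool" where
  "inverse_semigroup S \<longleftrightarrow>
     (\<forall>s\<in>carrier S. \<forall>t\<in>carrier S. s \<cdot>\<^bsub>S\<^esub> t \<in> carrier S) \<and>
     (\<forall>s\<in>carrier S. \<forall>t\<in>carrier S. \<forall>u\<in>carrier S.
        (s \<cdot>\<^bsub>S\<^esub> t) \<cdot>\<^bsub>S\<^esub> u = s \<cdot>\<^bsub>S\<^esub> (t \<cdot>\<^bsub>S\<^esub> u)) \<and>
     (\<forall>s\<in>carrier S. \<exists>!t. t \<in> carrier S \<and>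
        s = s \<cdot>\<^bsub>S\<^esub> t \<cdot>\<^bsub>S\<^esub> s \<and> t = t \<cdot>\<^bsub>S\<^esub> s \<cdot>\<^bsub>S\<^esub> t)"

definition star :: "'a sgrp \<Rightarrow> 'a \<Rightarrow> 'a" where
  "star S s = (THE t. t \<in> carrier S \<and>
     s = s \<cdot>\<^bsub>S\<^esub> t \<cdot>\<^bsub>S\<^esub> s \<and> t = t \<cdot>\<^bsub>S\<^esub> s \<cdot>\<^bsub>S\<^esub> t)"

definition idem :: "'a sgrp \<Rightarrow> 'a set" where
  "idem S = {e \<in> carrier S. e \<cdot>\<^bsub>S\<^esub> e = e}"

text \<open>Characters are kept extensional on the idempotents, so that equality of characters is
  equality of HOL functions and they are points of the product space indexed by
  \<^term>\<open>idem S\<close>.\<close>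

definition characters :: "'a sgrp \<Rightarrow> ('a \<Rightarrow> nat) set" where
  "characters S = {\<xi> \<in> idem S \<rightarrow>\<^sub>E {0, 1}.
     (\<forall>e\<in>idem S. \<forall>f\<in>idem S. \<xi> (e \<cdot>\<^bsub>S\<^esub> f) = \<xi> e * \<xi> f) \<and> (\<exists>e\<in>idem S. \<xi> e \<noteq> 0)}"

definition character_space :: "'a sgrp \<Rightarrow> ('a \<Rightarrow> nat) topology" where
  "character_space S =
     subtopology (product_topology (\<lambda>_. discrete_topology {0, 1}) (idem S)) (characters S)"

definition char_dom :: "'a sgrp \<Rightarrow> 'a \<Rightarrow> ('a \<Rightarrow> nat) set" where
  "char_dom S e = {\<xi> \<in> characters S. \<xi> e = 1}"

definition char_act :: "'a sgrp \<Rightarrow> 'a \<Rightarrow> ('a \<Rightarrow> nat) \<Rightarrow> 'a \<Rightarrow> nat" where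
  "char_act S s \<xi> = (\<lambda>e\<in>idem S. \<xi> (star S s \<cdot>\<^bsub>S\<^esub> e \<cdot>\<^bsub>S\<^esub> s))"

definition fixed_characters :: "'a sgrp \<Rightarrow> ('a \<Rightarrow> nat) set" where
  "fixed_characters S = {\<xi> \<in> characters S.
     \<forall>e\<in>idem S. \<forall>s\<in>carrier S. \<xi> (star S s \<cdot>\<^bsub>S\<^esub> s) = 1 \<longrightarrow>
       \<xi> (star S s \<cdot>\<^bsub>S\<^esub> e \<cdot>\<^bsub>S\<^esub> s) = \<xi> e}"

definition rho_Clif :: "'a sgrp \<Rightarrow> ('a \<times> 'a) set" where
  "rho_Clif S = {(e, f). e \<in> idem S \<and> f \<in> idem S \<and> (\<forall>\<xi>\<in>fixed_characters S. \<xi> e = \<xi> f)}"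

definition nu_Clif :: "'a sgrp \<Rightarrow> ('a \<times> 'a) set" where
  "nu_Clif S = {(s, t). s \<in> carrier S \<and> t \<in> carrier S \<and>
     (star S s \<cdot>\<^bsub>S\<^esub> s, star S t \<cdot>\<^bsub>S\<^esub> t) \<in> rho_Clif S \<and>
     (\<exists>e\<in>idem S. (e, star S s \<cdot>\<^bsub>S\<^esub> s) \<in> rho_Clif S \<and> s \<cdot>\<^bsub>S\<^esub> e = t \<cdot>\<^bsub>S\<^esub> e)}"

text \<open>Here and for the universal groupoid, an operation on equivalence classes is the union, over all
  representatives, of the classes of the results; when the operation is well defined, all these
  classes coincide.\<close>

definition Clif :: "'a sgrp \<Rightarrow> 'a set sgrp" where
  "Clif S = \<lparr>carrier = carrier S // nu_Clif S,
     mult = (\<lambda>A B. \<Union>a\<in>A. \<Union>b\<in>B. nu_Clif S `` {a \<cdot>\<^bsub>S\<^esub> b})\<rparr>"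

text \<open>The set of arrows is the underlying set of \<open>gtop\<close>, and the unit space is a subset of it.
  The product \<open>gmult G \<alpha> \<beta>\<close> is meaningful only if \<open>src G \<alpha> = tgt G \<beta>\<close>; the maps \<open>d\<close> and \<open>r\<close> of the
  literature are \<open>src\<close> and \<open>tgt\<close>.\<close>

record 'g gpd =
  gtop :: "'g topology"
  src :: "'g \<Rightarrow> 'g"
  tgt :: "'g \<Rightarrow> 'g"
  gmult :: "'g \<Rightarrow> 'g \<Rightarrow> 'g"
  ginv :: "'g \<Rightarrow> 'g"

abbreviation arrows :: "'g gpd \<Rightarrow> 'g set" where
  "arrows G \<equiv> topspace (gtop G)"

definition unit_space :: "'g gpd \<Rightarrow> 'g set" where
  "unit_space G = src G ` arrows G"

definition composable :: "'g gpd \<Rightarrow> ('g \<times> 'g) set" where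
  "composable G = {(\<alpha>, \<beta>). \<alpha> \<in> arrows G \<and> \<beta> \<in> arrows G \<and> src G \<alpha> = tgt G \<beta>}"

definition groupoid :: "'g gpd \<Rightarrow> bool" where
  "groupoid G \<longleftrightarrow>
     (\<forall>\<alpha>\<in>arrows G. src G \<alpha> \<in> arrows G \<and> tgt G \<alpha> \<in> arrows G \<and> ginv G \<alpha> \<in> arrows G \<and>
        src G (src G \<alpha>) = src G \<alpha> \<and> tgt G (src G \<alpha>) = src G \<alpha> \<and>
        src G (tgt G \<alpha>) = tgt G \<alpha> \<and> tgt G (tgt G \<alpha>) = tgt G \<alpha> \<and>
        src G (ginv G \<alpha>) = tgt G \<alpha> \<and> tgt G (ginv G \<alpha>) = src G \<alpha> \<and>
        gmult G \<alpha> (src G \<alpha>) = \<alpha> \<and> gmult G (tgt G \<alpha>) \<alpha> = \<alpha> \<and>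
        gmult G (ginv G \<alpha>) \<alpha> = src G \<alpha> \<and> gmult G \<alpha> (ginv G \<alpha>) = tgt G \<alpha>) \<and>
     (\<forall>(\<alpha>, \<beta>)\<in>composable G. gmult G \<alpha> \<beta> \<in> arrows G \<and>
        src G (gmult G \<alpha> \<beta>) = src G \<beta> \<and> tgt G (gmult G \<alpha> \<beta>) = tgt G \<alpha>) \<and>
     (\<forall>\<alpha> \<beta> \<gamma>. (\<alpha>, \<beta>) \<in> composable G \<and> (\<beta>, \<gamma>) \<in> composable G \<longrightarrow>
        gmult G (gmult G \<alpha> \<beta>) \<gamma> = gmult G \<alpha> (gmult G \<beta> \<gamma>))"

text \<open>Continuity of \<open>src\<close> and \<open>tgt\<close> follows from that of \<open>gmult\<close> and \<open>ginv\<close>.\<close>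

definition topological_groupoid :: "'g gpd \<Rightarrow> bool" where
  "topological_groupoid G \<longleftrightarrow> groupoid G \<and>
     continuous_map (subtopology (prod_topology (gtop G) (gtop G)) (composable G)) (gtop G)
       (\<lambda>(\<alpha>, \<beta>). gmult G \<alpha> \<beta>) \<and>
     continuous_map (gtop G) (gtop G) (ginv G)"

definition local_homeomorphism :: "'a topology \<Rightarrow> 'b topology \<Rightarrow> ('a \<Rightarrow> 'b) \<Rightarrow> bool" where
  "local_homeomorphism X Y f \<longleftrightarrow>
     (\<forall>x\<in>topspace X. \<exists>U. openin X U \<and> x \<in> U \<and> openin Y (f ` U) \<and>
        homeomorphic_map (subtopology X U) (subtopology Y (f ` U)) f)"

definition etale_groupoid :: "'g gpd \<Rightarrow> bool" where
  "etale_groupoid G \<longleftrightarrow> topological_groupoid G \<and>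
     local_homeomorphism (gtop G) (subtopology (gtop G) (unit_space G)) (src G)"

definition etale_groupoid_iso :: "'g gpd \<Rightarrow> 'h gpd \<Rightarrow> ('g \<Rightarrow> 'h) \<Rightarrow> bool" where
  "etale_groupoid_iso G H \<Phi> \<longleftrightarrow>
     homeomorphic_map (gtop G) (gtop H) \<Phi> \<and>
     (\<forall>\<alpha>\<in>arrows G. \<Phi> (src G \<alpha>) = src H (\<Phi> \<alpha>) \<and> \<Phi> (tgt G \<alpha>) = tgt H (\<Phi> \<alpha>) \<and>
        \<Phi> (ginv G \<alpha>) = ginv H (\<Phi> \<alpha>)) \<and>
     (\<forall>(\<alpha>, \<beta>)\<in>composable G. \<Phi> (gmult G \<alpha> \<beta>) = gmult H (\<Phi> \<alpha>) (\<Phi> \<beta>))"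

definition etale_groupoid_isomorphic :: "'g gpd \<Rightarrow> 'h gpd \<Rightarrow> bool" where
  "etale_groupoid_isomorphic G H \<longleftrightarrow>
     etale_groupoid G \<and> etale_groupoid H \<and> (\<exists>\<Phi>. etale_groupoid_iso G H \<Phi>)"

definition fixed_points :: "'g gpd \<Rightarrow> 'g set" where
  "fixed_points G = {x \<in> unit_space G. \<forall>\<alpha>\<in>arrows G. src G \<alpha> = x \<longrightarrow> tgt G \<alpha> = x}"

definition gpd_fix :: "'g gpd \<Rightarrow> 'g gpd" where
  "gpd_fix G = G\<lparr>gtop := subtopology (gtop G) {\<alpha> \<in> arrows G. src G \<alpha> \<in> fixed_points G}\<rparr>"

definition germ_rel :: "'a sgrp \<Rightarrow> (('a \<times> ('a \<Rightarrow> nat)) \<times> ('a \<times> ('a \<Rightarrow> nat))) set" where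
  "germ_rel S = {((s, \<xi>), (t, \<eta>)). s \<in> carrier S \<and> t \<in> carrier S \<and>
     \<xi> \<in> char_dom S (star S s \<cdot>\<^bsub>S\<^esub> s) \<and> \<eta> \<in> char_dom S (star S t \<cdot>\<^bsub>S\<^esub> t) \<and>
     \<xi> = \<eta> \<and> (\<exists>e\<in>idem S. \<xi> e = 1 \<and> s \<cdot>\<^bsub>S\<^esub> e = t \<cdot>\<^bsub>S\<^esub> e)}"

definition germ :: "'a sgrp \<Rightarrow> 'a \<Rightarrow> ('a \<Rightarrow> nat) \<Rightarrow> ('a \<times> ('a \<Rightarrow> nat)) set" where
  "germ S s \<xi> = germ_rel S `` {(s, \<xi>)}"

text \<open>The unit attached to a character \<open>\<xi>\<close>: the common value of \<open>germ S e \<xi>\<close> for all idempotents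
  \<open>e\<close> with \<open>\<xi> e = 1\<close>. Through it \<^term>\<open>characters S\<close> is identified with the unit space.\<close>

definition unit_germ :: "'a sgrp \<Rightarrow> ('a \<Rightarrow> nat) \<Rightarrow> ('a \<times> ('a \<Rightarrow> nat)) set" where
  "unit_germ S \<xi> = (\<Union>e\<in>{e \<in> idem S. \<xi> e = 1}. germ S e \<xi>)"

definition germ_basis :: "'a sgrp \<Rightarrow> ('a \<times> ('a \<Rightarrow> nat)) set set set" where
  "germ_basis S = {germ S s ` U | s U. s \<in> carrier S \<and>
     openin (character_space S) U \<and> U \<subseteq> char_dom S (star S s \<cdot>\<^bsub>S\<^esub> s)}"

definition universal_groupoid :: "'a sgrp \<Rightarrow> ('a \<times> ('a \<Rightarrow> nat)) set gpd" where
  "universal_groupoid S = \<lparr>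
     gtop = topology_generated_by (germ_basis S),
     src = (\<lambda>A. \<Union>(s, \<xi>)\<in>A. unit_germ S \<xi>),
     tgt = (\<lambda>A. \<Union>(s, \<xi>)\<in>A. unit_germ S (char_act S s \<xi>)),
     gmult = (\<lambda>A B. \<Union>(s, \<eta>)\<in>A. \<Union>(t, \<xi>)\<in>B. germ S (s \<cdot>\<^bsub>S\<^esub> t) \<xi>),
     ginv = (\<lambda>A. \<Union>(s, \<xi>)\<in>A. germ S (star S s) (char_act S s \<xi>))\<rparr>"

end

theory Submission
  imports Defs
begin

text \<open>Every fixed character \<open>\<eta>\<close> satisfies \<open>\<eta> (s\<^sup>* e s) = \<eta> (s\<^sup>* s e)\<close> for all \<open>s\<close> and \<open>e\<close>. Hence a
  character of \<open>S\<close> is constant on the classes of \<open>\<rho>\<^sub>C\<^sub>l\<^sub>i\<^sub>f\<close> exactly if it is fixed, and composition with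
  the quotient map identifies the characters of \<open>S\<^sup>C\<^sup>l\<^sup>i\<^sup>f\<close> with the fixed characters of \<open>S\<close>. These are
  the fixed points of the universal groupoid. The isomorphism is \<open>[[s], \<xi>] \<mapsto> [s, \<xi> \<circ> q]\<close>, where \<open>q\<close> is the
  quotient map: if \<open>s\<close> and \<open>t\<close> are congruent, then \<open>s e = t e\<close> for some \<open>e\<close> congruent to \<open>s\<^sup>* s\<close>, at
  which \<open>\<xi> \<circ> q\<close> is \<open>1\<close>, so that \<open>s\<close> and \<open>t\<close> have the same germ at \<open>\<xi> \<circ> q\<close>.\<close>

text \<open>The defining condition of a fixed character has a premise on \<open>s\<close>. The
  product form holds without it, because below an idempotent of value 0 every value is 0; so it is a
  statement about pairs of idempotents and can enter a congruence. For characters of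
  \<open>Clif S\<close> to be functions on the classes of \<open>rho_Clif\<close>, each idempotent
  class must contain an idempotent of \<open>S\<close>; this also makes idempotents of the quotient
  commute. Injectivity of the isomorphism needs more than constancy on classes: if
  \<open>s e\<close> and \<open>t e\<close> are congruent, the witnessing idempotent takes at every
  fixed character the value of the domain idempotent of \<open>s e\<close>. That value is 1 at the
  pulled back character, so the witness also equates the two germs in \<open>S\<close>. The fixed
  characters need not form an open set, so \<open>gpd_fix\<close> is in general not an open
  subgroupoid. It is etale because its arrows are the full preimage of the fixed points under the
  source map.\<close>

locale inverse_sgrp =
  fixes S :: "'a sgrp" (structure)
  assumes inverse_semigroup: "inverse_semigroup S"
begin

section \<open>Inverses and idempotents\<close>

lemma mult_closed [simp, intro]: "s \<in> carrier S \<Longrightarrow> t \<in> carrier S \<Longrightarrow> s \<cdot> t \<in> carrier S"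
  using inverse_semigroup unfolding inverse_semigroup_def by blast

lemma mult_assoc [simp]:
  "s \<in> carrier S \<Longrightarrow> t \<in> carrier S \<Longrightarrow> u \<in> carrier S \<Longrightarrow> s \<cdot> t \<cdot> u = s \<cdot> (t \<cdot> u)"
  using inverse_semigroup unfolding inverse_semigroup_def by blast

lemma star_ex1:
  "s \<in> carrier S \<Longrightarrow> \<exists>!t. t \<in> carrier S \<and> s = s \<cdot> t \<cdot> s \<and> t = t \<cdot> s \<cdot> t"
  using inverse_semigroup unfolding inverse_semigroup_def by (elim conjE) (rule bspec)

lemma
  assumes "s \<in> carrier S"
  shows star_closed [simp, intro]: "star S s \<in> carrier S"
    and mult_star_mult [simp]: "s \<cdot> (star S s \<cdot> s) = s"
    and star_mult_star [simp]: "star S s \<cdot> (s \<cdot> star S s) = star S s"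
proof -
  have *: "star S s \<in> carrier S \<and> s = s \<cdot> star S s \<cdot> s \<and> star S s = star S s \<cdot> s \<cdot> star S s"
    unfolding star_def by (rule theI'[OF star_ex1[OF assms]])
  then show "star S s \<in> carrier S" by blast
  with * assms show "s \<cdot> (star S s \<cdot> s) = s" "star S s \<cdot> (s \<cdot> star S s) = star S s"
    by (metis mult_assoc)+
qed

text \<open>With \<open>mult_assoc\<close> as a rewrite rule all products are nested to the right,
  so \<open>s s\<^sup>* s\<close> followed by a further factor is no instance of
  \<open>mult_star_mult\<close>. The versions with a tail \<open>t\<close> restore the
  cancellation.\<close>

lemma mult_star_mult' [simp]:
  assumes "s \<in> carrier S" "t \<in> carrier S"
  shows "s \<cdot> (star S s \<cdot> (s \<cdot> t)) = s \<cdot> t" "star S s \<cdot> (s \<cdot> (star S s \<cdot> t)) = star S s \<cdot> t"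
  using assms by (metis mult_assoc mult_closed mult_star_mult star_closed star_mult_star)+

lemma star_unique:
  assumes "s \<in> carrier S" "t \<in> carrier S" "s \<cdot> (t \<cdot> s) = s" "t \<cdot> (s \<cdot> t) = t"
  shows "star S s = t"
  unfolding star_def
  by (rule the1_equality[OF star_ex1]) (use assms in auto)

lemma star_star [simp]: "s \<in> carrier S \<Longrightarrow> star S (star S s) = s"
  by (rule star_unique) auto

lemma idem_carrier [simp, dest]: "e \<in> idem S \<Longrightarrow> e \<in> carrier S"
  by (simp add: idem_def)

lemma idemI: "e \<in> carrier S \<Longrightarrow> e \<cdot> e = e \<Longrightarrow> e \<in> idem S"
  unfolding idem_def by blast

lemma idem_idem [simp]: "e \<in> idem S \<Longrightarrow> e \<cdot> e = e"
  unfolding idem_def by blast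

lemma idem_idem' [simp]: "e \<in> idem S \<Longrightarrow> s \<in> carrier S \<Longrightarrow> e \<cdot> (e \<cdot> s) = e \<cdot> s"
  by (metis idem_carrier idem_idem mult_assoc)

lemma star_idem [simp]: "e \<in> idem S \<Longrightarrow> star S e = e"
  by (rule star_unique) auto

text \<open>If \<open>x\<close> is the inverse of \<open>e f\<close>, then so is \<open>f x e\<close>, which is idempotent.\<close>

lemma idem_mult [simp, intro]:
  assumes "e \<in> idem S" "f \<in> idem S" shows "e \<cdot> f \<in> idem S"
proof -
  define x where "x = star S (e \<cdot> f)"
  have x [simp]: "x \<in> carrier S" and 1: "e \<cdot> f \<cdot> (x \<cdot> (e \<cdot> f)) = e \<cdot> f" "x \<cdot> (e \<cdot> f \<cdot> x) = x"
    using assms unfolding x_def by (simp_all del: mult_assoc)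
  have 2: "x \<cdot> (e \<cdot> (f \<cdot> (x \<cdot> e))) = x \<cdot> e"
    using 1(2) assms mult_assoc[of x "e \<cdot> f \<cdot> x" e] by simp
  have "star S (e \<cdot> f) = f \<cdot> (x \<cdot> e)"
    by (rule star_unique) (use assms 1 2 in simp_all)
  then have "x = f \<cdot> (x \<cdot> e)" by (simp add: x_def)
  moreover have "f \<cdot> (x \<cdot> e) \<in> idem S"
    by (rule idemI) (use assms 2 in simp_all)
  ultimately have "x \<in> idem S" by simp
  \<comment> \<open>The inverse of \<open>x\<close> is \<open>e f\<close>, while the idempotent
    \<open>x\<close> is its own inverse. Hence \<open>e f\<close> equals \<open>x\<close>.\<close>
  then show ?thesis
    using star_star[of "e \<cdot> f"] assms unfolding x_def[symmetric] by simp
qed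

text \<open>As \<open>e f\<close> and \<open>f e\<close> are both idempotent, \<open>f e\<close> is
  an inverse of \<open>e f\<close>. The idempotent \<open>e f\<close> is its own inverse, and
  inverses are unique.\<close>

lemma idem_commute:
  assumes "e \<in> idem S" "f \<in> idem S" shows "e \<cdot> f = f \<cdot> e"
proof -
  have *: "e \<cdot> f \<in> idem S" "f \<cdot> e \<in> idem S" using assms by auto
  have "e \<cdot> (f \<cdot> (e \<cdot> f)) = e \<cdot> f" "f \<cdot> (e \<cdot> (f \<cdot> e)) = f \<cdot> e"
    using assms *[THEN idem_idem] by (metis idem_carrier mult_assoc mult_closed)+
  then have "star S (e \<cdot> f) = f \<cdot> e"
    by (intro star_unique) (use assms in simp_all)
  then show ?thesis using * by simp
qed

lemma idem_left_commute:
  assumes "e \<in> idem S" "f \<in> idem S" "s \<in> carrier S" shows "e \<cdot> (f \<cdot> s) = f \<cdot> (e \<cdot> s)"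
  using assms idem_commute[OF assms(1,2)] mult_assoc[of e f s] mult_assoc[of f e s] by simp

lemma star_mult_idem [simp, intro]: "s \<in> carrier S \<Longrightarrow> star S s \<cdot> s \<in> idem S"
  and mult_star_idem [simp, intro]: "s \<in> carrier S \<Longrightarrow> s \<cdot> star S s \<in> idem S"
  by (rule idemI; simp)+

lemma star_mult:
  assumes "s \<in> carrier S" "t \<in> carrier S" shows "star S (s \<cdot> t) = star S t \<cdot> star S s"
proof (rule star_unique)
  \<comment> \<open>The idempotents \<open>t t\<^sup>*\<close> and \<open>s\<^sup>* s\<close> meet
    inside both products to be checked. Swapping them places each next to a factor that absorbs it;
    \<open>2\<close> is the same swap with a tail.\<close>
  have 1: "t \<cdot> (star S t \<cdot> (star S s \<cdot> s)) = star S s \<cdot> (s \<cdot> (t \<cdot> star S t))"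
    using idem_commute[of "t \<cdot> star S t" "star S s \<cdot> s"] assms by simp
  then have 2: "t \<cdot> (star S t \<cdot> (star S s \<cdot> (s \<cdot> x))) = star S s \<cdot> (s \<cdot> (t \<cdot> (star S t \<cdot> x)))"
    if "x \<in> carrier S" for x
    using idem_left_commute[of "t \<cdot> star S t" "star S s \<cdot> s" x] assms that by simp
  show "s \<cdot> t \<cdot> (star S t \<cdot> star S s \<cdot> (s \<cdot> t)) = s \<cdot> t"
    using assms by (simp add: 2)
  show "star S t \<cdot> star S s \<cdot> (s \<cdot> t \<cdot> (star S t \<cdot> star S s)) = star S t \<cdot> star S s"
    using assms by (simp add: 2[symmetric])
qed (use assms in auto)

text \<open>An idempotent on the left of \<open>s\<close> can be moved to its right at the price of
  conjugation, since \<open>s s\<^sup>*\<close> commutes with \<open>e\<close>. This is the step by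
  which witnesses of equality are carried across a factor later on.\<close>

lemma mult_idem_eq:
  assumes "s \<in> carrier S" "e \<in> idem S"
  shows "s \<cdot> (star S s \<cdot> (e \<cdot> s)) = e \<cdot> s"
  using assms idem_left_commute[of "s \<cdot> star S s" e s] by simp

lemma conj_idem [simp, intro]:
  assumes "s \<in> carrier S" "e \<in> idem S" shows "star S s \<cdot> (e \<cdot> s) \<in> idem S"
  by (rule idemI) (use assms in \<open>simp_all add: mult_idem_eq\<close>)

text \<open>The inner \<open>s s\<^sup>*\<close> on the right moves past the idempotent and is
  absorbed by \<open>s\<close>. This makes \<open>char_act S s \<xi>\<close> multiplicative.\<close>

lemma conj_mult:
  assumes "s \<in> carrier S" "e \<in> idem S" "f \<in> idem S"
  shows "star S s \<cdot> (e \<cdot> (f \<cdot> s)) = star S s \<cdot> (e \<cdot> s) \<cdot> (star S s \<cdot> (f \<cdot> s))"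
  using assms by (simp add: mult_idem_eq)

end

text \<open>Uniqueness of inverses does not pass to a quotient directly, whereas existence does, and
  commutation of idempotents does as soon as idempotents lift. This is the criterion applied to
  \<open>Clif S\<close>.\<close>

lemma inverse_semigroupI:
  fixes S :: "'a sgrp" (structure)
  assumes closed: "\<And>s t. s \<in> carrier S \<Longrightarrow> t \<in> carrier S \<Longrightarrow> s \<cdot> t \<in> carrier S"
    and assoc: "\<And>s t u. s \<in> carrier S \<Longrightarrow> t \<in> carrier S \<Longrightarrow> u \<in> carrier S \<Longrightarrow>
      s \<cdot> t \<cdot> u = s \<cdot> (t \<cdot> u)"
    and regular: "\<And>s. s \<in> carrier S \<Longrightarrow>
      \<exists>t\<in>carrier S. s = s \<cdot> t \<cdot> s \<and> t = t \<cdot> s \<cdot> t"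
    and commute: "\<And>e f. e \<in> idem S \<Longrightarrow> f \<in> idem S \<Longrightarrow> e \<cdot> f = f \<cdot> e"
  shows "inverse_semigroup S"
proof -
  have "t = u"
    if [simp]: "s \<in> carrier S" "t \<in> carrier S" "u \<in> carrier S"
      and t: "s = s \<cdot> t \<cdot> s" "t = t \<cdot> s \<cdot> t" and u: "s = s \<cdot> u \<cdot> s" "u = u \<cdot> s \<cdot> u" for s t u
  proof -
    note [simp] = closed assoc
    have t': "s \<cdot> (t \<cdot> s) = s" "t \<cdot> (s \<cdot> t) = t" and u': "s \<cdot> (u \<cdot> s) = s" "u \<cdot> (s \<cdot> u) = u"
      using t u by (metis assoc that(1-3))+
    have idem: "t \<cdot> s \<in> idem S" "u \<cdot> s \<in> idem S" "s \<cdot> t \<in> idem S" "s \<cdot> u \<in> idem S"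
      by (simp_all add: idem_def t' u')
    \<comment> \<open>Two swaps lead from \<open>t\<close> to \<open>u\<close>. Exchanging
      \<open>t s\<close> and \<open>u s\<close> brings \<open>u\<close> to the left end; expanding
      \<open>s\<close> to \<open>s u s\<close> and exchanging \<open>s u\<close> with
      \<open>s t\<close> brings \<open>u\<close> to the right end, where \<open>s t s\<close>
      collapses.\<close>
    have "t = t \<cdot> (s \<cdot> (u \<cdot> s)) \<cdot> t"
      unfolding u'(1) by (rule t(2))
    also have "\<dots> = t \<cdot> s \<cdot> (u \<cdot> s) \<cdot> t"
      by simp
    also have "\<dots> = u \<cdot> s \<cdot> (t \<cdot> s) \<cdot> t"
      by (simp only: commute[OF idem(1,2)])
    also have "\<dots> = u \<cdot> (s \<cdot> (u \<cdot> s)) \<cdot> t"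
      by (simp add: t' u')
    also have "\<dots> = u \<cdot> (s \<cdot> u \<cdot> (s \<cdot> t))"
      by simp
    also have "\<dots> = u \<cdot> (s \<cdot> t \<cdot> (s \<cdot> u))"
      by (simp only: commute[OF idem(3,4)])
    also have "\<dots> = u \<cdot> (s \<cdot> (t \<cdot> s) \<cdot> u)"
      by simp
    also have "\<dots> = u"
      by (simp only: t' u')
    finally show ?thesis .
  qed
  note unique = this
  have "\<exists>!t. t \<in> carrier S \<and> s = s \<cdot> t \<cdot> s \<and> t = t \<cdot> s \<cdot> t"
    if s: "s \<in> carrier S" for s
    using regular[OF s] unique[OF s] by (elim bexE, intro ex1I) blast+
  with closed assoc show ?thesis
    unfolding inverse_semigroup_def by (intro conjI ballI) simp_all
qed

section \<open>Characters and the partial action on them\<close>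

context inverse_sgrp
begin

abbreviation dom :: "'a \<Rightarrow> ('a \<Rightarrow> nat) set" where
  "dom s \<equiv> char_dom S (star S s \<cdot> s)"

lemma char_dom_iff: "\<xi> \<in> char_dom S e \<longleftrightarrow> \<xi> \<in> characters S \<and> \<xi> e = 1"
  by (simp add: char_dom_def)

lemma domD: "\<xi> \<in> char_dom S e \<Longrightarrow> \<xi> \<in> characters S" "\<xi> \<in> char_dom S e \<Longrightarrow> \<xi> e = 1"
  by (simp_all add: char_dom_def)

lemma char_mult [simp]:
  "\<xi> \<in> characters S \<Longrightarrow> e \<in> idem S \<Longrightarrow> f \<in> idem S \<Longrightarrow> \<xi> (e \<cdot> f) = \<xi> e * \<xi> f"
  by (simp add: characters_def)

lemma characters_PiE: "\<xi> \<in> characters S \<Longrightarrow> \<xi> \<in> idem S \<rightarrow>\<^sub>E {0, 1}"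
  unfolding characters_def by (elim CollectE conjE)

lemma charactersI:
  assumes "\<xi> \<in> extensional (idem S)" "\<And>e. e \<in> idem S \<Longrightarrow> \<xi> e = 0 \<or> \<xi> e = 1"
    and "\<And>e f. e \<in> idem S \<Longrightarrow> f \<in> idem S \<Longrightarrow> \<xi> (e \<cdot> f) = \<xi> e * \<xi> f"
    and "e \<in> idem S" "\<xi> e = 1"
  shows "\<xi> \<in> characters S"
proof -
  have "\<xi> \<in> idem S \<rightarrow>\<^sub>E {0, 1}"
  proof (rule PiE_I)
    show "\<xi> e \<in> {0, 1}" if "e \<in> idem S" for e using assms(2)[OF that] by blast
  qed (rule extensional_arb[OF assms(1)])
  moreover have "\<exists>e\<in>idem S. \<xi> e \<noteq> 0"
    using assms(5) by (intro bexI[OF _ assms(4)]) simp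
  ultimately show ?thesis
    unfolding characters_def using assms(3) by (intro CollectI conjI ballI)
qed

lemma char_zero_or_one: "\<xi> \<in> characters S \<Longrightarrow> e \<in> idem S \<Longrightarrow> \<xi> e = 0 \<or> \<xi> e = 1"
  using PiE_mem[OF characters_PiE, of \<xi> e] by simp

lemma char_ex_one:
  assumes "\<xi> \<in> characters S" obtains e where "e \<in> idem S" "\<xi> e = 1"
proof -
  obtain e where "e \<in> idem S" "\<xi> e \<noteq> 0"
    using assms by (auto simp: characters_def)
  then show ?thesis
    using that[of e] char_zero_or_one[OF assms, of e] by simp
qed

lemma char_eqI:
  assumes "\<xi> \<in> characters S" "\<eta> \<in> characters S" "\<And>e. e \<in> idem S \<Longrightarrow> \<xi> e = \<eta> e"
  shows "\<xi> = \<eta>"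
proof (rule PiE_ext)
  show "\<xi> \<in> idem S \<rightarrow>\<^sub>E {0, 1}" "\<eta> \<in> idem S \<rightarrow>\<^sub>E {0, 1}"
    using assms(1,2) by (simp_all only: characters_PiE)
qed (rule assms(3))

lemma char_act_apply: "s \<in> carrier S \<Longrightarrow> e \<in> idem S \<Longrightarrow> char_act S s \<xi> e = \<xi> (star S s \<cdot> (e \<cdot> s))"
  by (simp add: char_act_def)

lemma char_act_dom:
  assumes s: "s \<in> carrier S" and \<xi>: "\<xi> \<in> dom s"
  shows "char_act S s \<xi> \<in> dom (star S s)"
proof -
  note [simp] = domD[OF \<xi>]
  have 1: "char_act S s \<xi> (s \<cdot> star S s) = 1"
    using s by (simp add: char_act_apply)
  have "char_act S s \<xi> (e \<cdot> f) = char_act S s \<xi> e * char_act S s \<xi> f"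
    if "e \<in> idem S" "f \<in> idem S" for e f
  proof -
    have "char_act S s \<xi> (e \<cdot> f) = \<xi> (star S s \<cdot> (e \<cdot> (f \<cdot> s)))"
      using s that by (simp add: char_act_apply)
    also have "\<dots> = \<xi> (star S s \<cdot> (e \<cdot> s)) * \<xi> (star S s \<cdot> (f \<cdot> s))"
      unfolding conj_mult[OF s that] using s that by (intro char_mult) simp_all
    finally show ?thesis using s that by (simp add: char_act_apply)
  qed
  then have "char_act S s \<xi> \<in> characters S"
    using s 1 char_zero_or_one[of \<xi>]
    by (intro charactersI[of _ "s \<cdot> star S s"]) (simp_all add: char_act_apply, simp add: char_act_def)
  then show ?thesis
    using 1 s by (simp add: char_dom_iff)
qed

lemma char_act_characters:
  "s \<in> carrier S \<Longrightarrow> \<xi> \<in> dom s \<Longrightarrow> char_act S s \<xi> \<in> characters S"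
  using char_act_dom domD(1) by blast

text \<open>The domain idempotent of \<open>s t\<close> is \<open>t\<^sup>* s\<^sup>* s t\<close>,
  at which \<xi> takes the value of \<open>char_act S t \<xi>\<close> at \<open>s\<^sup>* s\<close>.
  It lies below \<open>t\<^sup>* t\<close>, so the value 1 there also puts \<xi> into
  \<open>dom t\<close>.\<close>

lemma dom_mult:
  assumes "s \<in> carrier S" "t \<in> carrier S"
  shows "\<xi> \<in> dom (s \<cdot> t) \<longleftrightarrow> \<xi> \<in> dom t \<and> char_act S t \<xi> \<in> dom s"
proof
  assume \<xi>: "\<xi> \<in> dom (s \<cdot> t)"
  note [simp] = domD(1)[OF \<xi>]
  have 1: "\<xi> (star S t \<cdot> (star S s \<cdot> (s \<cdot> t))) = 1"
    using domD(2)[OF \<xi>] assms by (simp add: star_mult)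
  have "star S t \<cdot> (star S s \<cdot> (s \<cdot> t)) = star S t \<cdot> ((star S s \<cdot> s) \<cdot> t) \<cdot> (star S t \<cdot> t)"
    using assms by simp
  with 1 have "\<xi> (star S t \<cdot> ((star S s \<cdot> s) \<cdot> t)) * \<xi> (star S t \<cdot> t) = 1"
    using assms char_mult[of \<xi> "star S t \<cdot> ((star S s \<cdot> s) \<cdot> t)" "star S t \<cdot> t"]
    by (metis conj_idem star_mult_idem domD(1)[OF \<xi>])
  then have t: "\<xi> \<in> dom t" by (simp add: char_dom_iff)
  moreover have "char_act S t \<xi> (star S s \<cdot> s) = 1"
    using 1 assms by (simp add: char_act_apply)
  ultimately show "\<xi> \<in> dom t \<and> char_act S t \<xi> \<in> dom s"
    using char_act_characters[OF assms(2) t] by (simp add: char_dom_iff)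
next
  assume "\<xi> \<in> dom t \<and> char_act S t \<xi> \<in> dom s"
  then show "\<xi> \<in> dom (s \<cdot> t)"
    using assms by (auto simp: char_dom_iff char_act_apply star_mult)
qed

lemma char_act_mult:
  assumes "s \<in> carrier S" "t \<in> carrier S" "\<xi> \<in> dom (s \<cdot> t)"
  shows "char_act S s (char_act S t \<xi>) = char_act S (s \<cdot> t) \<xi>"
  by (rule char_eqI)
    (use assms dom_mult[of s t] in \<open>auto intro!: char_act_characters simp: char_act_apply star_mult\<close>)

lemma dom_idem: "e \<in> idem S \<Longrightarrow> dom e = char_dom S e"
  by simp

lemma char_act_idem:
  assumes "e \<in> idem S" "\<xi> \<in> char_dom S e"
  shows "char_act S e \<xi> = \<xi>"
  by (rule char_eqI)
    (use assms domD[of \<xi>] in \<open>auto intro!: char_act_characters simp: char_act_apply\<close>)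

lemma char_act_star:
  assumes "s \<in> carrier S" "\<xi> \<in> dom s"
  shows "char_act S (star S s) (char_act S s \<xi>) = \<xi>"
  using assms by (subst char_act_mult) (auto intro!: char_act_idem)

section \<open>Germs, and the structure maps evaluated on representatives\<close>

lemma equiv_germ_rel: "equiv {(s, \<xi>). s \<in> carrier S \<and> \<xi> \<in> dom s} (germ_rel S)"
proof (rule equivI)
  show "refl_on {(s, \<xi>). s \<in> carrier S \<and> \<xi> \<in> dom s} (germ_rel S)"
    by (rule refl_onI) (auto simp: germ_rel_def char_dom_iff intro!: bexI[OF _ star_mult_idem])
  show "germ_rel S \<subseteq> {(s, \<xi>). s \<in> carrier S \<and> \<xi> \<in> dom s} \<times> {(s, \<xi>). s \<in> carrier S \<and> \<xi> \<in> dom s}"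
    by (auto simp: germ_rel_def)
  show "sym (germ_rel S)"
    by (rule symI) (force simp: germ_rel_def)
  show "trans (germ_rel S)"
  proof (rule transI)
    fix x y z assume "(x, y) \<in> germ_rel S" "(y, z) \<in> germ_rel S"
    then obtain s t u \<xi> e f where xyz: "x = (s, \<xi>)" "y = (t, \<xi>)" "z = (u, \<xi>)"
      and c: "s \<in> carrier S" "t \<in> carrier S" "u \<in> carrier S" "\<xi> \<in> dom s" "\<xi> \<in> dom t" "\<xi> \<in> dom u"
      and e: "e \<in> idem S" "\<xi> e = 1" "s \<cdot> e = t \<cdot> e" and f: "f \<in> idem S" "\<xi> f = 1" "t \<cdot> f = u \<cdot> f"
      by (auto simp: germ_rel_def)
    have "s \<cdot> (e \<cdot> f) = t \<cdot> (e \<cdot> f)"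
      using c e f mult_assoc[of s e f] mult_assoc[of t e f] by simp
    also have "\<dots> = u \<cdot> (e \<cdot> f)"
      using c e f mult_assoc[of u f e] mult_assoc[of t f e] idem_commute[OF e(1) f(1)] by simp
    finally show "(x, z) \<in> germ_rel S"
      using c e f domD[of \<xi>] by (auto simp: germ_rel_def xyz intro!: bexI[of _ "e \<cdot> f"])
  qed
qed

lemma germ_eq_iff:
  assumes "s \<in> carrier S" "\<xi> \<in> dom s" "t \<in> carrier S" "\<eta> \<in> dom t"
  shows "germ S s \<xi> = germ S t \<eta> \<longleftrightarrow> \<xi> = \<eta> \<and> (\<exists>e\<in>idem S. \<xi> e = 1 \<and> s \<cdot> e = t \<cdot> e)"
proof -
  have "germ S s \<xi> = germ S t \<eta> \<longleftrightarrow> ((s, \<xi>), (t, \<eta>)) \<in> germ_rel S"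
    unfolding germ_def using assms by (intro eq_equiv_class_iff[OF equiv_germ_rel]) auto
  then show ?thesis using assms by (simp add: germ_rel_def)
qed

lemma germ_eqI:
  assumes "s \<in> carrier S" "\<xi> \<in> dom s" "t \<in> carrier S" "\<xi> \<in> dom t"
    and "e \<in> idem S" "\<xi> e = 1" "s \<cdot> e = t \<cdot> e"
  shows "germ S s \<xi> = germ S t \<xi>"
  using assms germ_eq_iff by blast

lemma germ_self: "s \<in> carrier S \<Longrightarrow> \<xi> \<in> dom s \<Longrightarrow> (s, \<xi>) \<in> germ S s \<xi>"
  unfolding germ_def by (rule equiv_class_self[OF equiv_germ_rel]) auto

lemma germD:
  assumes "(t, \<eta>) \<in> germ S s \<xi>"
  shows "\<eta> = \<xi>" "s \<in> carrier S" "t \<in> carrier S" "\<xi> \<in> dom s" "\<xi> \<in> dom t"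
    "\<exists>e\<in>idem S. \<xi> e = 1 \<and> s \<cdot> e = t \<cdot> e"
  using assms unfolding germ_def germ_rel_def by auto

lemma mult_idem_dom:
  assumes "s \<in> carrier S" "\<xi> \<in> dom s" "e \<in> idem S" "\<xi> e = 1"
  shows "\<xi> \<in> dom (s \<cdot> e)" "char_act S (s \<cdot> e) \<xi> = char_act S s \<xi>"
proof -
  have e: "\<xi> \<in> char_dom S e" "\<xi> \<in> dom e" using assms by (simp_all add: char_dom_iff)
  then show *: "\<xi> \<in> dom (s \<cdot> e)"
    using assms by (simp add: dom_mult char_act_idem del: mult_assoc)
  show "char_act S (s \<cdot> e) \<xi> = char_act S s \<xi>"
    using * assms e by (subst char_act_mult[symmetric]) (simp_all add: char_act_idem)
qed

text \<open>Two representatives agree after multiplication by an idempotent of value 1, and such a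
  multiplication leaves the action on \<xi> unchanged.\<close>

lemma char_act_germ:
  assumes "(t, \<eta>) \<in> germ S s \<xi>" shows "char_act S t \<eta> = char_act S s \<xi>"
proof -
  note t = germD[OF assms]
  then obtain e where "e \<in> idem S" "\<xi> e = 1" "s \<cdot> e = t \<cdot> e" by blast
  then show ?thesis using t mult_idem_dom(2) by metis
qed

text \<open>Operations on classes are encoded as unions over representatives. Such a union has the
  intended value once all representatives give the same class; that the class is nonempty is also
  used, as an empty union would be empty.\<close>

lemma germ_UN_eq:
  assumes "s \<in> carrier S" "\<xi> \<in> dom s" and "\<And>t \<eta>. (t, \<eta>) \<in> germ S s \<xi> \<Longrightarrow> F t \<eta> = C"
  shows "(\<Union>(t, \<eta>)\<in>germ S s \<xi>. F t \<eta>) = C"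
proof (rule SUP_eq_const)
  show "germ S s \<xi> \<noteq> {}" using germ_self[OF assms(1,2)] by blast
qed (use assms(3) in auto)

lemma unit_germ_eq:
  assumes "e \<in> idem S" "\<xi> \<in> char_dom S e"
  shows "unit_germ S \<xi> = germ S e \<xi>"
  unfolding unit_germ_def
proof (rule SUP_eq_const)
  show "{e \<in> idem S. \<xi> e = 1} \<noteq> {}" using assms domD(2) by blast
  fix f assume "f \<in> {e \<in> idem S. \<xi> e = 1}"
  then have f: "f \<in> idem S" "\<xi> f = 1" by simp_all
  show "germ S f \<xi> = germ S e \<xi>"
  proof (rule germ_eqI)
    \<comment> \<open>The product of \<open>e\<close> and \<open>f\<close> again has value 1 at
      \<xi> and is fixed by left multiplication with either factor, so it witnesses that the two
      germs agree.\<close>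
    show "f \<cdot> (e \<cdot> f) = e \<cdot> (e \<cdot> f)"
      using assms f idem_left_commute[of f e f] by simp
  qed (use assms f in \<open>auto simp: char_dom_iff\<close>)
qed

lemma unit_germ_inject:
  assumes "\<xi> \<in> characters S" "\<eta> \<in> characters S"
  shows "unit_germ S \<xi> = unit_germ S \<eta> \<longleftrightarrow> \<xi> = \<eta>"
proof
  obtain e f where ef: "e \<in> idem S" "\<xi> e = 1" "f \<in> idem S" "\<eta> f = 1"
    using assms char_ex_one by metis
  assume "unit_germ S \<xi> = unit_germ S \<eta>"
  then have "germ S e \<xi> = germ S f \<eta>"
    using assms ef by (simp add: unit_germ_eq[of e \<xi>] unit_germ_eq[of f \<eta>] char_dom_iff)
  then show "\<xi> = \<eta>"
    using assms ef by (subst (asm) germ_eq_iff) (simp_all add: char_dom_iff)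
qed simp

lemma src_germ:
  assumes "s \<in> carrier S" "\<xi> \<in> dom s"
  shows "src (universal_groupoid S) (germ S s \<xi>) = unit_germ S \<xi>"
  unfolding universal_groupoid_def gpd.simps
  by (rule germ_UN_eq[OF assms]) (drule germD(1), simp)

lemma tgt_germ:
  assumes "s \<in> carrier S" "\<xi> \<in> dom s"
  shows "tgt (universal_groupoid S) (germ S s \<xi>) = unit_germ S (char_act S s \<xi>)"
  unfolding universal_groupoid_def gpd.simps
  by (rule germ_UN_eq[OF assms]) (simp add: char_act_germ)

lemma gmult_germ:
  assumes "s \<in> carrier S" "t \<in> carrier S" "\<xi> \<in> dom t" "char_act S t \<xi> \<in> dom s"
  shows "gmult (universal_groupoid S) (germ S s (char_act S t \<xi>)) (germ S t \<xi>) = germ S (s \<cdot> t) \<xi>"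
proof -
  have *: "germ S (s' \<cdot> t') \<xi>' = germ S (s \<cdot> t) \<xi>"
    if "(s', \<eta>) \<in> germ S s (char_act S t \<xi>)" "(t', \<xi>') \<in> germ S t \<xi>" for s' t' \<eta> \<xi>'
  proof -
    note s' = germD[OF that(1)] and t' = germD[OF that(2)]
    from s' obtain f where f: "f \<in> idem S" "char_act S t \<xi> f = 1" "s \<cdot> f = s' \<cdot> f"
      by blast
    from t' obtain e where e: "e \<in> idem S" "\<xi> e = 1" "t \<cdot> e = t' \<cdot> e"
      by blast
    \<comment> \<open>Equality of \<open>s\<close> and \<open>s'\<close> is available at
      \<open>f\<close>, which stands to the left of \<open>t\<close>. Conjugation by
      \<open>t\<close> carries it to the right, and the factor \<open>e\<close> makes
      \<open>t\<close> and \<open>t'\<close> agree as well.\<close>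
    define g where "g = star S t \<cdot> (f \<cdot> t) \<cdot> e"
    have ft: "star S t \<cdot> (f \<cdot> t) \<in> idem S" using assms f by simp
    have g: "g \<in> idem S" "\<xi> g = 1"
      using assms f e ft domD[OF assms(3)] unfolding g_def
      by (simp_all add: char_act_apply del: mult_assoc)
    have tg: "t \<cdot> g = f \<cdot> t \<cdot> e"
      using assms f e mult_idem_eq[of t f] mult_assoc[of t "star S t \<cdot> (f \<cdot> t)" e]
      unfolding g_def by simp
    have t'g: "t' \<cdot> g = t \<cdot> g"
      using assms f e t' ft mult_assoc[of t' e "star S t \<cdot> (f \<cdot> t)"] mult_assoc[of t e "star S t \<cdot> (f \<cdot> t)"]
      unfolding g_def idem_commute[OF ft e(1)] by (metis idem_carrier)
    have eq: "s' \<cdot> t' \<cdot> g = s \<cdot> t \<cdot> g"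
    proof -
      have "s' \<cdot> t' \<cdot> g = s' \<cdot> f \<cdot> t \<cdot> e"
        using s' t' g assms f e by (simp add: t'g tg)
      also have "\<dots> = s \<cdot> t \<cdot> g"
        using s' t' g assms f(1) e(1) by (simp add: f(3)[symmetric] tg del: mult_assoc) (simp add: tg)
      finally show ?thesis .
    qed
    show ?thesis
      unfolding t'(1)
      by (rule germ_eqI[where e = g])
        (use s'(3,5) t'(3,5) g eq assms char_act_germ[OF that(2)] in
          \<open>simp_all add: dom_mult t'(1) del: mult_assoc\<close>)
  qed
  show ?thesis
    unfolding universal_groupoid_def gpd.simps using assms *
    by (intro germ_UN_eq) blast+
qed

lemma ginv_germ:
  assumes "s \<in> carrier S" "\<xi> \<in> dom s"
  shows "ginv (universal_groupoid S) (germ S s \<xi>) = germ S (star S s) (char_act S s \<xi>)"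
  unfolding universal_groupoid_def gpd.simps
proof (rule germ_UN_eq[OF assms])
  fix t \<eta> assume *: "(t, \<eta>) \<in> germ S s \<xi>"
  note t = germD[OF *]
  then obtain e where e: "e \<in> idem S" "\<xi> e = 1" "s \<cdot> e = t \<cdot> e" by blast
  \<comment> \<open>Taking inverses in \<open>s e = t e\<close> gives
    \<open>e s\<^sup>* = e t\<^sup>*\<close>, an equality on the wrong side. The idempotent
    \<open>s e s\<^sup>*\<close> is the image of \<open>e\<close> on the range side: multiplying it
    on the left by \<open>s\<^sup>*\<close> gives \<open>e s\<^sup>*\<close>, and likewise for
    \<open>t\<close>.\<close>
  define g where "g = s \<cdot> (e \<cdot> star S s)"
  have "e \<cdot> star S s = e \<cdot> star S t"
    using star_mult[of s e] star_mult[of t e] e t by simp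
  then have g': "g = t \<cdot> (e \<cdot> star S t)"
    using e t mult_assoc[of s e "star S t"] mult_assoc[of t e "star S t"] unfolding g_def by simp
  have *: "star S u \<cdot> (u \<cdot> (e \<cdot> star S u)) = e \<cdot> star S u" if "u \<in> carrier S" for u
    using idem_left_commute[of "star S u \<cdot> u" e "star S u"] that e by simp
  have "star S t \<cdot> g = star S s \<cdot> g"
    using *[of s] *[of t] t \<open>e \<cdot> star S s = e \<cdot> star S t\<close> g' g_def by simp
  moreover have "g \<in> idem S"
    using conj_idem[of "star S s" e] t e unfolding g_def by simp
  moreover have "char_act S s \<xi> g = 1"
  proof -
    have "star S s \<cdot> (g \<cdot> s) = e \<cdot> (star S s \<cdot> s)"
      using t e idem_left_commute[of "star S s \<cdot> s" e "star S s \<cdot> s"] unfolding g_def by simp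
    then show ?thesis
      using t e \<open>g \<in> idem S\<close> domD[OF assms(2)] by (simp add: char_act_apply)
  qed
  ultimately show "germ S (star S t) (char_act S t \<eta>) = germ S (star S s) (char_act S s \<xi>)"
    using t char_act_dom[of s \<xi>] char_act_dom[of t \<xi>]
    unfolding char_act_germ[OF \<open>(t, \<eta>) \<in> germ S s \<xi>\<close>]
    by (intro germ_eqI[where e = g]) (auto simp: char_act_germ[OF \<open>(t, \<eta>) \<in> germ S s \<xi>\<close>, unfolded t(1)])
qed

subsection \<open>The topology of the universal groupoid\<close>

lemma topspace_character_space [simp]: "topspace (character_space S) = characters S"
proof -
  have "characters S \<subseteq> idem S \<rightarrow>\<^sub>E {0, 1}" using characters_PiE by blast
  then show ?thesis
    unfolding character_space_def topspace_subtopology topspace_product_topology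
      topspace_discrete_topology by (rule Int_absorb1)
qed

lemma continuous_map_character_eval:
  "e \<in> idem S \<Longrightarrow> continuous_map (character_space S) (discrete_topology {0, 1}) (\<lambda>\<xi>. \<xi> e)"
  unfolding character_space_def
  by (intro continuous_map_from_subtopology continuous_map_product_projection)

lemma continuous_map_into_character_space:
  assumes "\<And>x. x \<in> topspace X \<Longrightarrow> f x \<in> characters S"
    and "\<And>e. e \<in> idem S \<Longrightarrow> continuous_map X (discrete_topology {0, 1}) (\<lambda>x. f x e)"
  shows "continuous_map X (character_space S) f"
  unfolding character_space_def continuous_map_in_subtopology continuous_map_componentwise
  using assms characters_PiE[OF assms(1)] by (auto simp: PiE_def Pi_def)

lemma openin_char_dom:
  assumes "e \<in> idem S" shows "openin (character_space S) (char_dom S e)"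
  using openin_continuous_map_preimage[OF continuous_map_character_eval[OF assms], of "{1}"]
  by (simp add: char_dom_def)

lemma openin_dom: "s \<in> carrier S \<Longrightarrow> openin (character_space S) (dom s)"
  by (simp add: openin_char_dom)

lemma continuous_map_char_act:
  assumes "s \<in> carrier S"
  shows "continuous_map (subtopology (character_space S) (dom s)) (character_space S) (char_act S s)"
proof (rule continuous_map_into_character_space)
  fix \<xi> assume "\<xi> \<in> topspace (subtopology (character_space S) (dom s))"
  then show "char_act S s \<xi> \<in> characters S"
    using assms by (simp add: char_act_characters)
next
  fix e assume e: "e \<in> idem S"
  show "continuous_map (subtopology (character_space S) (dom s)) (discrete_topology {0, 1})
      (\<lambda>\<xi>. char_act S s \<xi> e)"
    unfolding char_act_apply[OF assms e]
    by (intro continuous_map_from_subtopology continuous_map_character_eval conj_idem assms e)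
qed

abbreviation G :: "('a \<times> ('a \<Rightarrow> nat)) set gpd" where
  "G \<equiv> universal_groupoid S"

lemma arrows_universal_groupoid: "arrows G = {germ S s \<xi> | s \<xi>. s \<in> carrier S \<and> \<xi> \<in> dom s}"
proof -
  have "arrows G = \<Union>(germ_basis S)"
    by (simp add: universal_groupoid_def)
  also have "\<dots> = {germ S s \<xi> | s \<xi>. s \<in> carrier S \<and> \<xi> \<in> dom s}"
  proof (intro equalityI subsetI)
    fix \<alpha> assume "\<alpha> \<in> {germ S s \<xi> | s \<xi>. s \<in> carrier S \<and> \<xi> \<in> dom s}"
    then obtain s \<xi> where "s \<in> carrier S" "\<xi> \<in> dom s" "\<alpha> = germ S s \<xi>" by blast
    moreover from this have "germ S s ` dom s \<in> germ_basis S"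
      unfolding germ_basis_def using openin_dom by blast
    ultimately show "\<alpha> \<in> \<Union>(germ_basis S)" by blast
  qed (unfold germ_basis_def, blast)
  finally show ?thesis .
qed

lemma germ_in_arrows: "s \<in> carrier S \<Longrightarrow> \<xi> \<in> dom s \<Longrightarrow> germ S s \<xi> \<in> arrows G"
  unfolding arrows_universal_groupoid by blast

lemma arrowE:
  assumes "\<alpha> \<in> arrows G" obtains s \<xi> where "s \<in> carrier S" "\<xi> \<in> dom s" "\<alpha> = germ S s \<xi>"
  using assms unfolding arrows_universal_groupoid by blast

text \<open>The topology is the final one for the maps \<open>\<xi> \<mapsto> [s, \<xi>]\<close>.\<close>

lemma openin_universal_groupoid:
  "openin (gtop G) W \<longleftrightarrow>
     W \<subseteq> arrows G \<and> (\<forall>s\<in>carrier S. openin (character_space S) {\<xi> \<in> dom s. germ S s \<xi> \<in> W})"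
proof (intro iffI conjI ballI)
  assume W: "openin (gtop G) W"
  then show "W \<subseteq> arrows G" by (rule openin_subset)
  fix s assume s: "s \<in> carrier S"
  from W have "generate_topology_on (germ_basis S) W"
    by (simp add: universal_groupoid_def openin_topology_generated_by)
  then show "openin (character_space S) {\<xi> \<in> dom s. germ S s \<xi> \<in> W}"
  proof induction
    case Empty
    then show ?case by simp
  next
    case (Int a b)
    have "{\<xi> \<in> dom s. germ S s \<xi> \<in> a \<inter> b} = {\<xi> \<in> dom s. germ S s \<xi> \<in> a} \<inter> {\<xi> \<in> dom s. germ S s \<xi> \<in> b}"
      by blast
    then show ?case using openin_Int[OF Int.IH] by simp
  next
    case (UN K)
    have "{\<xi> \<in> dom s. germ S s \<xi> \<in> \<Union>K} = (\<Union>k\<in>K. {\<xi> \<in> dom s. germ S s \<xi> \<in> k})"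
      by blast
    then show ?case using UN.IH by auto
  next
    case (Basis B)
    then obtain t V where B: "B = germ S t ` V" and t: "t \<in> carrier S"
      and V: "openin (character_space S) V" "V \<subseteq> dom t"
      unfolding germ_basis_def by blast
    \<comment> \<open>The germs of \<open>s\<close> and \<open>t\<close> coincide exactly on the
      union of the open sets \<open>char_dom S e\<close>, within the common domain, over all
      idempotents \<open>e\<close> with \<open>s e = t e\<close>. This is why preimages of basic
      sets are open.\<close>
    have "{\<xi> \<in> dom s. germ S s \<xi> \<in> B} =
      (\<Union>e\<in>{e \<in> idem S. s \<cdot> e = t \<cdot> e}. dom s \<inter> (char_dom S e \<inter> V))" (is "?L = ?R")
    proof (intro equalityI subsetI)
      fix \<xi> assume "\<xi> \<in> ?L"
      then obtain \<eta> where \<xi>: "\<xi> \<in> dom s" and \<eta>: "\<eta> \<in> V" "\<eta> \<in> dom t" "germ S s \<xi> = germ S t \<eta>"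
        using B V by blast
      then have "\<xi> = \<eta> \<and> (\<exists>e\<in>idem S. \<xi> e = 1 \<and> s \<cdot> e = t \<cdot> e)"
        using germ_eq_iff[OF s _ t] by blast
      then show "\<xi> \<in> ?R" using \<xi> \<eta> by (auto simp: char_dom_iff)
    next
      fix \<xi> assume "\<xi> \<in> ?R"
      then obtain e where e: "e \<in> idem S" "s \<cdot> e = t \<cdot> e" "\<xi> \<in> dom s" "\<xi> e = 1" "\<xi> \<in> V"
        by (auto simp: char_dom_iff)
      then have "germ S s \<xi> = germ S t \<xi>"
        using germ_eqI[OF s _ t] V by blast
      then show "\<xi> \<in> ?L" using e B by blast
    qed
    moreover have "openin (character_space S) ?R"
      using s V by (auto intro!: openin_Union openin_Int openin_dom openin_char_dom)
    ultimately show ?case by simp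
  qed
next
  assume W: "W \<subseteq> arrows G \<and> (\<forall>s\<in>carrier S. openin (character_space S) {\<xi> \<in> dom s. germ S s \<xi> \<in> W})"
  \<comment> \<open>Each set of the union is the part of \<open>W\<close> lying in the slice of one
    \<open>s\<close>, and it is a basic set by assumption.\<close>
  have "W = (\<Union>s\<in>carrier S. germ S s ` {\<xi> \<in> dom s. germ S s \<xi> \<in> W})"
    using W unfolding arrows_universal_groupoid by blast
  moreover have "openin (gtop G) (germ S s ` {\<xi> \<in> dom s. germ S s \<xi> \<in> W})" if "s \<in> carrier S" for s
    unfolding universal_groupoid_def gpd.simps
    by (rule topology_generated_by_Basis) (use W that in \<open>unfold germ_basis_def, blast\<close>)
  ultimately show "openin (gtop G) W"
    by (metis (no_types, lifting) openin_Union imageE)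
qed

lemma openin_germ_image:
  assumes "s \<in> carrier S" "openin (character_space S) U" "U \<subseteq> dom s"
  shows "openin (gtop G) (germ S s ` U)"
  unfolding universal_groupoid_def gpd.simps
  by (rule topology_generated_by_Basis) (use assms in \<open>unfold germ_basis_def, blast\<close>)

section \<open>Units, composable pairs and the groupoid laws\<close>

lemma unit_germ_dom: "s \<in> carrier S \<Longrightarrow> \<xi> \<in> dom s \<Longrightarrow> unit_germ S \<xi> = germ S (star S s \<cdot> s) \<xi>"
  by (rule unit_germ_eq) auto

lemma unit_germE:
  assumes "\<xi> \<in> characters S"
  obtains e where "e \<in> idem S" "\<xi> \<in> dom e" "\<xi> \<in> char_dom S e" "unit_germ S \<xi> = germ S e \<xi>"
  using char_ex_one[OF assms] assms unit_germ_eq by (metis char_dom_iff dom_idem)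

lemma src_tgt_unit_germ:
  assumes "\<xi> \<in> characters S"
  shows "unit_germ S \<xi> \<in> arrows G" "src G (unit_germ S \<xi>) = unit_germ S \<xi>"
    "tgt G (unit_germ S \<xi>) = unit_germ S \<xi>"
proof -
  obtain e where e: "e \<in> idem S" "\<xi> \<in> dom e" "\<xi> \<in> char_dom S e" "unit_germ S \<xi> = germ S e \<xi>"
    using unit_germE[OF assms] .
  note c = idem_carrier[OF e(1)]
  show "unit_germ S \<xi> \<in> arrows G"
    unfolding e(4) by (rule germ_in_arrows[OF c e(2)])
  have "src G (germ S e \<xi>) = unit_germ S \<xi>" by (rule src_germ[OF c e(2)])
  then show "src G (unit_germ S \<xi>) = unit_germ S \<xi>" by (simp only: e(4))
  have "tgt G (germ S e \<xi>) = unit_germ S \<xi>"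
    using tgt_germ[OF c e(2)] char_act_idem[OF e(1,3)] by simp
  then show "tgt G (unit_germ S \<xi>) = unit_germ S \<xi>" by (simp only: e(4))
qed

lemma unit_space_universal_groupoid: "unit_space G = unit_germ S ` characters S"
proof (intro equalityI subsetI)
  fix x assume "x \<in> unit_space G"
  then obtain s \<xi> where "s \<in> carrier S" "\<xi> \<in> dom s" "x = src G (germ S s \<xi>)"
    unfolding unit_space_def by (auto elim: arrowE)
  then show "x \<in> unit_germ S ` characters S"
    using src_germ domD(1) by blast
next
  fix x assume "x \<in> unit_germ S ` characters S"
  then show "x \<in> unit_space G"
    unfolding unit_space_def using src_tgt_unit_germ by (metis imageE imageI)
qed

text \<open>Since a character is determined by its unit, equality of source and target forces the
  character of the left germ to be \<open>char_act S t \<xi>\<close>. Every composable pair thus has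
  the shape required by \<open>gmult_germ\<close>.\<close>

lemma composableE:
  assumes "(\<alpha>, \<beta>) \<in> composable G"
  obtains s t \<xi> where "s \<in> carrier S" "t \<in> carrier S" "\<xi> \<in> dom t" "char_act S t \<xi> \<in> dom s"
    "\<alpha> = germ S s (char_act S t \<xi>)" "\<beta> = germ S t \<xi>"
proof -
  from assms have "\<alpha> \<in> arrows G" "\<beta> \<in> arrows G" and eq: "src G \<alpha> = tgt G \<beta>"
    by (simp_all add: composable_def)
  then obtain s \<eta> t \<xi> where c: "s \<in> carrier S" "\<eta> \<in> dom s" "\<alpha> = germ S s \<eta>"
    "t \<in> carrier S" "\<xi> \<in> dom t" "\<beta> = germ S t \<xi>"
    by (metis arrowE)
  with eq have "unit_germ S \<eta> = unit_germ S (char_act S t \<xi>)"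
    by (simp add: src_germ tgt_germ)
  then have "\<eta> = char_act S t \<xi>"
    using c unit_germ_inject char_act_characters domD(1) by blast
  then show ?thesis using that c by blast
qed

lemma groupoid_universal_groupoid: "groupoid G"
  unfolding groupoid_def
proof (intro conjI ballI allI impI)
  fix \<alpha> assume "\<alpha> \<in> arrows G"
  then obtain s \<xi> where s: "s \<in> carrier S" and \<xi>: "\<xi> \<in> dom s" and \<alpha>: "\<alpha> = germ S s \<xi>"
    by (rule arrowE)
  define \<eta> where "\<eta> = char_act S s \<xi>"
  have \<eta>: "\<eta> \<in> characters S" "\<eta> \<in> dom (star S s)" and \<xi>': "\<xi> \<in> characters S"
    using s \<xi> char_act_dom[OF s \<xi>] domD(1) unfolding \<eta>_def by blast+
  have act: "char_act S (star S s) \<eta> = \<xi>"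
    using char_act_star[OF s \<xi>] by (simp add: \<eta>_def)
  have src: "src G \<alpha> = unit_germ S \<xi>" and tgt: "tgt G \<alpha> = unit_germ S \<eta>"
    and inv: "ginv G \<alpha> = germ S (star S s) \<eta>"
    using s \<xi> by (simp_all add: \<alpha> \<eta>_def src_germ tgt_germ ginv_germ)
  show "src G \<alpha> \<in> arrows G" "tgt G \<alpha> \<in> arrows G" "src G (src G \<alpha>) = src G \<alpha>"
    "tgt G (src G \<alpha>) = src G \<alpha>" "src G (tgt G \<alpha>) = tgt G \<alpha>" "tgt G (tgt G \<alpha>) = tgt G \<alpha>"
    unfolding src tgt using \<xi>' \<eta> by (simp_all add: src_tgt_unit_germ)
  show "ginv G \<alpha> \<in> arrows G" "src G (ginv G \<alpha>) = tgt G \<alpha>" "tgt G (ginv G \<alpha>) = src G \<alpha>"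
    unfolding inv src tgt using s \<eta> by (simp_all add: germ_in_arrows src_germ tgt_germ act)
  have e: "star S s \<cdot> s \<in> idem S" "s \<cdot> star S s \<in> idem S" using s by simp_all
  have u\<xi>: "unit_germ S \<xi> = germ S (star S s \<cdot> s) \<xi>"
    and u\<eta>: "unit_germ S \<eta> = germ S (s \<cdot> star S s) \<eta>"
    using unit_germ_dom[OF s \<xi>] unit_germ_dom[of "star S s" \<eta>] s \<eta> by simp_all
  have ae: "char_act S (star S s \<cdot> s) \<xi> = \<xi>" using char_act_idem[OF e(1)] \<xi> by simp
  have "gmult G (germ S s (char_act S (star S s \<cdot> s) \<xi>)) (germ S (star S s \<cdot> s) \<xi>)
      = germ S (s \<cdot> (star S s \<cdot> s)) \<xi>"
    by (rule gmult_germ) (use s \<xi> e ae in simp_all)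
  then have "gmult G \<alpha> (unit_germ S \<xi>) = \<alpha>"
    using s by (simp add: u\<xi> \<alpha> ae)
  then show "gmult G \<alpha> (src G \<alpha>) = \<alpha>" by (simp only: src)
  have "gmult G (germ S (s \<cdot> star S s) (char_act S s \<xi>)) (germ S s \<xi>)
      = germ S (s \<cdot> star S s \<cdot> s) \<xi>"
    by (rule gmult_germ) (use s \<xi> e \<eta> in \<open>simp_all add: \<eta>_def[symmetric]\<close>)
  then have "gmult G (unit_germ S \<eta>) \<alpha> = \<alpha>"
    using s unfolding u\<eta> \<alpha> by (simp add: \<eta>_def)
  then show "gmult G (tgt G \<alpha>) \<alpha> = \<alpha>" by (simp only: tgt)
  have "gmult G (germ S (star S s) (char_act S s \<xi>)) (germ S s \<xi>) = germ S (star S s \<cdot> s) \<xi>"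
    by (rule gmult_germ) (use s \<xi> \<eta> in \<open>simp_all add: \<eta>_def[symmetric]\<close>)
  then have "gmult G (germ S (star S s) \<eta>) \<alpha> = unit_germ S \<xi>"
    unfolding u\<xi> \<alpha> \<eta>_def .
  then show "gmult G (ginv G \<alpha>) \<alpha> = src G \<alpha>" by (simp only: src inv)
  have "gmult G (germ S s (char_act S (star S s) \<eta>)) (germ S (star S s) \<eta>) = germ S (s \<cdot> star S s) \<eta>"
    by (rule gmult_germ) (use s \<xi> \<eta> act in simp_all)
  then have "gmult G \<alpha> (germ S (star S s) \<eta>) = unit_germ S \<eta>"
    unfolding u\<eta> \<alpha> act .
  then show "gmult G \<alpha> (ginv G \<alpha>) = tgt G \<alpha>" by (simp only: tgt inv)
next
  fix p assume "p \<in> composable G"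
  moreover obtain \<alpha> \<beta> where p: "p = (\<alpha>, \<beta>)" by (cases p)
  ultimately obtain s t \<xi> where c: "s \<in> carrier S" "t \<in> carrier S" "\<xi> \<in> dom t" "char_act S t \<xi> \<in> dom s"
    and \<alpha>\<beta>: "\<alpha> = germ S s (char_act S t \<xi>)" "\<beta> = germ S t \<xi>"
    using composableE by blast
  have st: "\<xi> \<in> dom (s \<cdot> t)" using c dom_mult by blast
  have "gmult G \<alpha> \<beta> = germ S (s \<cdot> t) \<xi>" using gmult_germ[OF c] \<alpha>\<beta> by simp
  then show "case p of (\<alpha>, \<beta>) \<Rightarrow> gmult G \<alpha> \<beta> \<in> arrows G \<and>
      src G (gmult G \<alpha> \<beta>) = src G \<beta> \<and> tgt G (gmult G \<alpha> \<beta>) = tgt G \<alpha>"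
    using c st by (simp add: p \<alpha>\<beta> germ_in_arrows src_germ tgt_germ char_act_mult)
next
  fix \<alpha> \<beta> \<gamma> assume *: "(\<alpha>, \<beta>) \<in> composable G \<and> (\<beta>, \<gamma>) \<in> composable G"
  then obtain t u \<xi> where c: "t \<in> carrier S" "u \<in> carrier S" "\<xi> \<in> dom u" "char_act S u \<xi> \<in> dom t"
    and \<beta>\<gamma>: "\<beta> = germ S t (char_act S u \<xi>)" "\<gamma> = germ S u \<xi>"
    using composableE by blast
  obtain s \<eta> where s: "s \<in> carrier S" "\<eta> \<in> dom s" "\<alpha> = germ S s \<eta>"
    using * arrowE unfolding composable_def by blast
  have tu: "\<xi> \<in> dom (t \<cdot> u)" using c dom_mult by blast
  note act = char_act_mult[OF c(1,2) tu]
  have "unit_germ S \<eta> = unit_germ S (char_act S t (char_act S u \<xi>))"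
    using * s c unfolding composable_def \<beta>\<gamma> by (simp add: src_germ tgt_germ)
  then have \<eta>: "\<eta> = char_act S t (char_act S u \<xi>)"
    using s c unit_germ_inject char_act_characters domD(1) by blast
  have st: "char_act S u \<xi> \<in> dom (s \<cdot> t)"
    using dom_mult[OF s(1) c(1)] c s(2) \<eta> by blast
  have "gmult G (gmult G \<alpha> \<beta>) \<gamma> = germ S (s \<cdot> t \<cdot> u) \<xi>"
    unfolding s(3) \<beta>\<gamma> \<eta> using c s \<eta> st by (simp add: gmult_germ del: mult_assoc)
  moreover have "gmult G \<alpha> (gmult G \<beta> \<gamma>) = germ S (s \<cdot> (t \<cdot> u)) \<xi>"
    unfolding s(3) \<beta>\<gamma> \<eta> using c s \<eta> st tu by (simp add: gmult_germ act)
  ultimately show "gmult G (gmult G \<alpha> \<beta>) \<gamma> = gmult G \<alpha> (gmult G \<beta> \<gamma>)"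
    using c s by simp
qed

section \<open>Continuity of the structure maps, and \<open>src\<close> as a local
  homeomorphism\<close>

lemma continuous_map_from_universal_groupoid:
  assumes "\<And>\<alpha>. \<alpha> \<in> arrows G \<Longrightarrow> f \<alpha> \<in> topspace Y"
    and "\<And>s V. s \<in> carrier S \<Longrightarrow> openin Y V \<Longrightarrow>
      openin (character_space S) {\<xi> \<in> dom s. f (germ S s \<xi>) \<in> V}"
  shows "continuous_map (gtop G) Y f"
  unfolding continuous_map_def
proof (intro conjI allI impI)
  show "f \<in> arrows G \<rightarrow> topspace Y" using assms(1) by blast
  fix V assume V: "openin Y V"
  have "{\<xi> \<in> dom s. germ S s \<xi> \<in> {\<alpha> \<in> arrows G. f \<alpha> \<in> V}} = {\<xi> \<in> dom s. f (germ S s \<xi>) \<in> V}"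
    if "s \<in> carrier S" for s
    using germ_in_arrows[OF that] by blast
  then show "openin (gtop G) {\<alpha> \<in> arrows G. f \<alpha> \<in> V}"
    unfolding openin_universal_groupoid using assms(2)[OF _ V] by auto
qed

lemma continuous_map_ginv: "continuous_map (gtop G) (gtop G) (ginv G)"
proof (rule continuous_map_from_universal_groupoid)
  show "ginv G \<alpha> \<in> arrows G" if "\<alpha> \<in> arrows G" for \<alpha>
    using groupoid_universal_groupoid that unfolding groupoid_def by blast
  fix s V assume s: "s \<in> carrier S" and V: "openin (gtop G) V"
  let ?V = "{\<eta> \<in> dom (star S s). germ S (star S s) \<eta> \<in> V}"
  have V': "openin (character_space S) ?V"
    using V star_closed[OF s] unfolding openin_universal_groupoid by blast
  have "openin (subtopology (character_space S) (dom s)) {\<xi> \<in> characters S \<inter> dom s. char_act S s \<xi> \<in> ?V}"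
    using openin_continuous_map_preimage[OF continuous_map_char_act[OF s] V'] by simp
  moreover have "{\<xi> \<in> characters S \<inter> dom s. char_act S s \<xi> \<in> ?V} = {\<xi> \<in> dom s. ginv G (germ S s \<xi>) \<in> V}"
    using s char_act_dom[OF s] ginv_germ[OF s] domD(1) by auto
  ultimately show "openin (character_space S) {\<xi> \<in> dom s. ginv G (germ S s \<xi>) \<in> V}"
    using openin_open_subtopology[OF openin_dom[OF s]] by auto
qed

lemma continuous_map_gmult:
  "continuous_map (subtopology (prod_topology (gtop G) (gtop G)) (composable G)) (gtop G)
     (\<lambda>(\<alpha>, \<beta>). gmult G \<alpha> \<beta>)"
  unfolding continuous_map_def
proof (intro conjI allI impI)
  let ?X = "subtopology (prod_topology (gtop G) (gtop G)) (composable G)"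
  show "(\<lambda>(\<alpha>, \<beta>). gmult G \<alpha> \<beta>) \<in> topspace ?X \<rightarrow> arrows G"
    using groupoid_universal_groupoid unfolding groupoid_def by auto
  fix W assume W: "openin (gtop G) W"
  show "openin ?X {p \<in> topspace ?X. (case p of (\<alpha>, \<beta>) \<Rightarrow> gmult G \<alpha> \<beta>) \<in> W}"
  proof (subst openin_subopen, intro ballI)
    fix p assume p: "p \<in> {p \<in> topspace ?X. (case p of (\<alpha>, \<beta>) \<Rightarrow> gmult G \<alpha> \<beta>) \<in> W}"
    obtain \<alpha> \<beta> where "p = (\<alpha>, \<beta>)" by (cases p)
    with p have p: "p = (\<alpha>, \<beta>)" "(\<alpha>, \<beta>) \<in> composable G" "gmult G \<alpha> \<beta> \<in> W" by auto
    obtain s t \<xi> where c: "s \<in> carrier S" "t \<in> carrier S" "\<xi> \<in> dom t" "char_act S t \<xi> \<in> dom s"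
      and \<alpha>\<beta>: "\<alpha> = germ S s (char_act S t \<xi>)" "\<beta> = germ S t \<xi>"
      using composableE[OF p(2)] .
    define U where "U = {\<xi> \<in> dom (s \<cdot> t). germ S (s \<cdot> t) \<xi> \<in> W}"
    have U: "openin (character_space S) U"
      using W c unfolding openin_universal_groupoid U_def by blast
    have Ut: "U \<subseteq> dom t" using dom_mult[OF c(1,2)] unfolding U_def by blast
    have \<xi>: "\<xi> \<in> U" using p(3) gmult_germ[OF c] c dom_mult[OF c(1,2)] unfolding U_def \<alpha>\<beta> by simp
    \<comment> \<open>Only the right factor has to be shrunk to \<open>U\<close>: in a composable
      pair taken from these two slices, the character of the left germ is determined by that of the
      right one, so the product is the germ of \<open>s \<cdot> t\<close> at a point of
      \<open>U\<close>.\<close>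
    define T where "T = composable G \<inter> (germ S s ` dom s \<times> germ S t ` U)"
    have "openin (prod_topology (gtop G) (gtop G)) (germ S s ` dom s \<times> germ S t ` U)"
      unfolding openin_prod_Times_iff using openin_germ_image c openin_dom U Ut by blast
    then have "openin ?X T"
      unfolding T_def by (rule openin_subtopology_Int2)
    moreover have "p \<in> T"
      using p(1,2) c \<xi> unfolding T_def \<alpha>\<beta> by blast
    moreover have "T \<subseteq> {p \<in> topspace ?X. (case p of (\<alpha>, \<beta>) \<Rightarrow> gmult G \<alpha> \<beta>) \<in> W}"
    proof
      fix q assume q: "q \<in> T"
      then obtain \<eta> \<zeta> where \<eta>: "\<eta> \<in> dom s" and \<zeta>: "\<zeta> \<in> U" and q': "q = (germ S s \<eta>, germ S t \<zeta>)"
        "q \<in> composable G"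
        unfolding T_def by blast
      have \<zeta>t: "\<zeta> \<in> dom t" using \<zeta> Ut by blast
      have "unit_germ S \<eta> = unit_germ S (char_act S t \<zeta>)"
        using q' \<eta> \<zeta>t c unfolding composable_def by (simp add: src_germ tgt_germ)
      then have \<eta>': "\<eta> = char_act S t \<zeta>"
        using \<eta> \<zeta>t c unit_germ_inject char_act_characters domD(1) by blast
      have "gmult G (germ S s \<eta>) (germ S t \<zeta>) \<in> W"
        using gmult_germ[OF c(1,2) \<zeta>t] \<eta> \<eta>' \<zeta> unfolding U_def by simp
      moreover have "q \<in> topspace ?X"
        using q \<open>openin ?X T\<close> openin_subset by blast
      ultimately show "q \<in> {p \<in> topspace ?X. (case p of (\<alpha>, \<beta>) \<Rightarrow> gmult G \<alpha> \<beta>) \<in> W}"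
        using q' by simp
    qed
    ultimately show "\<exists>T. openin ?X T \<and> p \<in> T \<and> T \<subseteq> {p \<in> topspace ?X. (case p of (\<alpha>, \<beta>) \<Rightarrow> gmult G \<alpha> \<beta>) \<in> W}"
      by blast
  qed
qed

lemma continuous_map_src: "continuous_map (gtop G) (gtop G) (src G)"
proof (rule continuous_map_from_universal_groupoid)
  show "src G \<alpha> \<in> arrows G" if "\<alpha> \<in> arrows G" for \<alpha>
    using groupoid_universal_groupoid that unfolding groupoid_def by blast
  fix s V assume s: "s \<in> carrier S" and V: "openin (gtop G) V"
  have "{\<xi> \<in> dom s. src G (germ S s \<xi>) \<in> V} =
      {\<xi> \<in> dom (star S s \<cdot> s). germ S (star S s \<cdot> s) \<xi> \<in> V}"
    using s by (auto simp: src_germ unit_germ_dom)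
  moreover have "star S s \<cdot> s \<in> carrier S" using s by simp
  ultimately show "openin (character_space S) {\<xi> \<in> dom s. src G (germ S s \<xi>) \<in> V}"
    using V unfolding openin_universal_groupoid by presburger
qed

text \<open>On the slice of \<open>s\<close> the source map sends the germ of \<open>s\<close> at
  \<xi> to the germ of \<open>s\<^sup>* s\<close> at \<xi>. The set of parameters stays the same,
  and it is open because \<open>W\<close> is.\<close>

lemma openin_src_image:
  assumes "s \<in> carrier S" "openin (gtop G) W" "W \<subseteq> germ S s ` dom s"
  shows "openin (gtop G) (src G ` W)"
proof -
  let ?U = "{\<xi> \<in> dom s. germ S s \<xi> \<in> W}"
  have "W = germ S s ` ?U" using assms(3) by blast
  then have "src G ` W = (\<lambda>\<xi>. src G (germ S s \<xi>)) ` ?U"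
    by (metis image_image)
  also have "\<dots> = germ S (star S s \<cdot> s) ` ?U"
    using assms(1) by (intro image_cong) (auto simp: src_germ unit_germ_dom)
  finally have "src G ` W = germ S (star S s \<cdot> s) ` ?U" .
  moreover have "openin (character_space S) ?U"
    using assms unfolding openin_universal_groupoid by blast
  ultimately show ?thesis
    using assms(1) openin_germ_image[of "star S s \<cdot> s" ?U] by auto
qed

text \<open>The slice of a representative \<open>s\<close>, the image of \<open>dom s\<close> under
  \<open>germ S s\<close>, is the required neighbourhood: \<xi> can be read off from the source, so
  \<open>src\<close> is injective on it, and it is open there by
  \<open>openin_src_image\<close>.\<close>

theorem etale_universal_groupoid: "etale_groupoid G"
  unfolding etale_groupoid_def topological_groupoid_def local_homeomorphism_def
proof (intro conjI ballI)
  let ?Y = "subtopology (gtop G) (unit_space G)"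
  fix \<alpha> assume "\<alpha> \<in> arrows G"
  then obtain s \<xi> where s: "s \<in> carrier S" and \<xi>: "\<xi> \<in> dom s" and \<alpha>: "\<alpha> = germ S s \<xi>"
    by (rule arrowE)
  define U where "U = germ S s ` dom s"
  have U: "openin (gtop G) U" "U \<subseteq> arrows G"
    using openin_germ_image[OF s openin_dom[OF s]] openin_subset unfolding U_def by blast+
  have img: "openin ?Y (src G ` W)" if "openin (gtop G) W" "W \<subseteq> U" for W
  proof -
    have "src G ` W \<subseteq> unit_space G" using that U(2) unfolding unit_space_def by blast
    then show ?thesis
      using openin_src_image[OF s that[unfolded U_def]] by (metis inf.absorb2 openin_subtopology_Int2)
  qed
  have "openin (gtop G) (src G ` U)"
    using openin_src_image[OF s U(1)] unfolding U_def by simp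
  then have sU: "src G ` U \<subseteq> arrows G" "src G ` U \<subseteq> unit_space G"
    using U(2) openin_subset unfolding unit_space_def by blast+
  have "homeomorphic_map (subtopology (gtop G) U) (subtopology ?Y (src G ` U)) (src G)"
  proof (rule bijective_open_imp_homeomorphic_map)
    show "continuous_map (subtopology (gtop G) U) (subtopology ?Y (src G ` U)) (src G)"
      using continuous_map_from_subtopology[OF continuous_map_src] sU
      by (auto simp: subtopology_subtopology continuous_map_in_subtopology)
    show "open_map (subtopology (gtop G) U) (subtopology ?Y (src G ` U)) (src G)"
      unfolding open_map_def
    proof (intro allI impI)
      fix W assume "openin (subtopology (gtop G) U) W"
      then have "openin (gtop G) W" "W \<subseteq> U" by (simp_all add: openin_open_subtopology[OF U(1)])
      then show "openin (subtopology ?Y (src G ` U)) (src G ` W)"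
        using img by (metis image_mono inf.absorb2 openin_subtopology_Int2)
    qed
    show "src G ` topspace (subtopology (gtop G) U) = topspace (subtopology ?Y (src G ` U))"
      using sU U(2) by auto
    show "inj_on (src G) (topspace (subtopology (gtop G) U))"
    proof (rule inj_onI)
      fix \<beta> \<gamma> assume "\<beta> \<in> topspace (subtopology (gtop G) U)" "\<gamma> \<in> topspace (subtopology (gtop G) U)"
        and eq: "src G \<beta> = src G \<gamma>"
      then obtain \<eta> \<zeta> where "\<eta> \<in> dom s" "\<zeta> \<in> dom s" "\<beta> = germ S s \<eta>" "\<gamma> = germ S s \<zeta>"
        unfolding U_def by auto
      then show "\<beta> = \<gamma>"
        using eq s unit_germ_inject domD(1) by (metis src_germ)
    qed
  qed
  then show "\<exists>U. openin (gtop G) U \<and> \<alpha> \<in> U \<and> openin ?Y (src G ` U) \<and>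
      homeomorphic_map (subtopology (gtop G) U) (subtopology ?Y (src G ` U)) (src G)"
    using U(1) img[OF U(1)] \<xi> unfolding \<alpha> U_def by blast
qed (fact groupoid_universal_groupoid continuous_map_gmult continuous_map_ginv)+

end

subsection \<open>Restriction to the fixed points\<close>

lemma fixed_points_tgt:
  "\<alpha> \<in> arrows G \<Longrightarrow> src G \<alpha> \<in> fixed_points G \<Longrightarrow> tgt G \<alpha> = src G \<alpha>"
  unfolding fixed_points_def by blast

lemma gpd_fix_simps [simp]:
  "gtop (gpd_fix G) = subtopology (gtop G) {\<alpha> \<in> arrows G. src G \<alpha> \<in> fixed_points G}"
  "src (gpd_fix G) = src G" "tgt (gpd_fix G) = tgt G"
  "gmult (gpd_fix G) = gmult G" "ginv (gpd_fix G) = ginv G"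
  by (simp_all add: gpd_fix_def)

lemma arrows_gpd_fix: "arrows (gpd_fix G) = {\<alpha> \<in> arrows G. src G \<alpha> \<in> fixed_points G}"
  by auto

lemma composable_gpd_fix: "composable (gpd_fix G) \<subseteq> composable G"
  unfolding composable_def by auto

text \<open>Over a fixed point source and target coincide, so the restriction is a bundle of groups.
  Its arrows are singled out by their source alone, which makes closure under inverses and products
  immediate.\<close>

lemma groupoid_gpd_fix:
  assumes G: "groupoid G" shows "groupoid (gpd_fix G)"
proof -
  have 1: "src G \<alpha> \<in> arrows G \<and> ginv G \<alpha> \<in> arrows G \<and> src G (src G \<alpha>) = src G \<alpha> \<and>
      tgt G (src G \<alpha>) = src G \<alpha> \<and> src G (ginv G \<alpha>) = tgt G \<alpha> \<and> tgt G (ginv G \<alpha>) = src G \<alpha> \<and>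
      gmult G \<alpha> (src G \<alpha>) = \<alpha> \<and> gmult G (tgt G \<alpha>) \<alpha> = \<alpha> \<and>
      gmult G (ginv G \<alpha>) \<alpha> = src G \<alpha> \<and> gmult G \<alpha> (ginv G \<alpha>) = tgt G \<alpha> \<and> tgt G \<alpha> = src G \<alpha>"
    if "\<alpha> \<in> arrows (gpd_fix G)" for \<alpha>
    using G that fixed_points_tgt[of \<alpha> G] unfolding arrows_gpd_fix groupoid_def by blast
  \<comment> \<open>\<open>1\<close> identifies target and source on these arrows, so the left unit
    law is also recorded with the source in place of the target.\<close>
  have src_mult: "gmult G (src G \<alpha>) \<alpha> = \<alpha>" if "\<alpha> \<in> arrows (gpd_fix G)" for \<alpha>
    using 1[OF that] by metis
  have 2: "gmult G \<alpha> \<beta> \<in> arrows G \<and> src G (gmult G \<alpha> \<beta>) = src G \<beta> \<and> tgt G (gmult G \<alpha> \<beta>) = tgt G \<alpha>"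
    if "(\<alpha>, \<beta>) \<in> composable (gpd_fix G)" for \<alpha> \<beta>
    using G that composable_gpd_fix[of G] unfolding groupoid_def by blast
  show ?thesis
    unfolding groupoid_def
  proof (intro conjI ballI allI impI)
    fix p assume p: "p \<in> composable (gpd_fix G)"
    then have "snd p \<in> arrows (gpd_fix G)" unfolding composable_def by auto
    with p 2[of "fst p" "snd p"]
    show "case p of (\<alpha>, \<beta>) \<Rightarrow> gmult (gpd_fix G) \<alpha> \<beta> \<in> arrows (gpd_fix G) \<and>
        src (gpd_fix G) (gmult (gpd_fix G) \<alpha> \<beta>) = src (gpd_fix G) \<beta> \<and>
        tgt (gpd_fix G) (gmult (gpd_fix G) \<alpha> \<beta>) = tgt (gpd_fix G) \<alpha>"
      unfolding arrows_gpd_fix by (cases p) simp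
  next
    fix \<alpha> \<beta> \<gamma> assume "(\<alpha>, \<beta>) \<in> composable (gpd_fix G) \<and> (\<beta>, \<gamma>) \<in> composable (gpd_fix G)"
    then have "(\<alpha>, \<beta>) \<in> composable G \<and> (\<beta>, \<gamma>) \<in> composable G"
      using composable_gpd_fix[of G] by blast
    then have "gmult G (gmult G \<alpha> \<beta>) \<gamma> = gmult G \<alpha> (gmult G \<beta> \<gamma>)"
      using G unfolding groupoid_def by blast
    then show "gmult (gpd_fix G) (gmult (gpd_fix G) \<alpha> \<beta>) \<gamma> = gmult (gpd_fix G) \<alpha> (gmult (gpd_fix G) \<beta> \<gamma>)"
      by simp
  qed (use 1 src_mult in \<open>simp_all add: arrows_gpd_fix\<close>)
qed

lemma fixed_points_subset: "fixed_points G \<subseteq> unit_space G"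
  unfolding fixed_points_def by blast

lemma fixed_points_arrows:
  assumes "groupoid G" "x \<in> fixed_points G"
  shows "x \<in> arrows (gpd_fix G)" "src G x = x"
  using assms unfolding groupoid_def arrows_gpd_fix fixed_points_def unit_space_def by auto

lemma unit_space_gpd_fix:
  assumes "groupoid G" shows "unit_space (gpd_fix G) = fixed_points G"
proof (intro equalityI subsetI)
  fix x assume "x \<in> unit_space (gpd_fix G)"
  then show "x \<in> fixed_points G"
    unfolding unit_space_def arrows_gpd_fix by auto
next
  fix x assume "x \<in> fixed_points G"
  then show "x \<in> unit_space (gpd_fix G)"
    using fixed_points_arrows[OF assms] unfolding unit_space_def
    by (intro image_eqI[of _ _ x]) simp_all
qed

theorem etale_gpd_fix:
  assumes "etale_groupoid G" shows "etale_groupoid (gpd_fix G)"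
proof -
  have grp: "groupoid G" and inv: "continuous_map (gtop G) (gtop G) (ginv G)"
    and mul: "continuous_map (subtopology (prod_topology (gtop G) (gtop G)) (composable G)) (gtop G)
       (\<lambda>(\<alpha>, \<beta>). gmult G \<alpha> \<beta>)"
    and loc: "local_homeomorphism (gtop G) (subtopology (gtop G) (unit_space G)) (src G)"
    using assms unfolding etale_groupoid_def topological_groupoid_def by blast+
  have fix_grp: "groupoid (gpd_fix G)" using groupoid_gpd_fix[OF grp] .
  define A where "A = arrows (gpd_fix G)"
  have top: "gtop (gpd_fix G) = subtopology (gtop G) A"
    unfolding A_def arrows_gpd_fix by (rule gpd_fix_simps)
  have A: "A \<subseteq> arrows G" "fixed_points G \<subseteq> A"
    using fixed_points_arrows[OF grp] unfolding A_def by auto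
  have inv_A: "ginv G \<alpha> \<in> A" if "\<alpha> \<in> A" for \<alpha>
    using fix_grp that unfolding groupoid_def A_def gpd_fix_simps(5) by blast
  have mul_A: "gmult G \<alpha> \<beta> \<in> A" if "(\<alpha>, \<beta>) \<in> composable (gpd_fix G)" for \<alpha> \<beta>
    using fix_grp that unfolding groupoid_def A_def by fastforce
  have "continuous_map (gtop (gpd_fix G)) (gtop (gpd_fix G)) (ginv (gpd_fix G))"
    using inv_A continuous_map_from_subtopology[OF inv] unfolding top
    by (auto simp: continuous_map_in_subtopology)
  moreover have "continuous_map (subtopology (prod_topology (gtop (gpd_fix G)) (gtop (gpd_fix G)))
      (composable (gpd_fix G))) (gtop (gpd_fix G)) (\<lambda>(\<alpha>, \<beta>). gmult (gpd_fix G) \<alpha> \<beta>)"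
    unfolding top subtopology_Times[symmetric] subtopology_subtopology
    using mul_A continuous_map_from_subtopology_mono[OF mul, of "A \<times> A \<inter> composable (gpd_fix G)"]
      composable_gpd_fix[of G]
    by (auto simp: continuous_map_in_subtopology)
  moreover have "local_homeomorphism (gtop (gpd_fix G))
      (subtopology (gtop (gpd_fix G)) (fixed_points G)) (src (gpd_fix G))"
    unfolding local_homeomorphism_def
  proof
    fix \<alpha> assume "\<alpha> \<in> arrows (gpd_fix G)"
    then have \<alpha>: "\<alpha> \<in> A" "\<alpha> \<in> arrows G" using A(1) by (auto simp: A_def)
    then obtain U where U: "openin (gtop G) U" "\<alpha> \<in> U"
      "openin (subtopology (gtop G) (unit_space G)) (src G ` U)"
      and homeo: "homeomorphic_map (subtopology (gtop G) U)
        (subtopology (subtopology (gtop G) (unit_space G)) (src G ` U)) (src G)"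
      using loc unfolding local_homeomorphism_def by blast
    have Uar: "U \<subseteq> arrows G" using U(1) by (rule openin_subset)
    have A_iff: "\<beta> \<in> A \<longleftrightarrow> src G \<beta> \<in> fixed_points G" if "\<beta> \<in> U" for \<beta>
      using that Uar unfolding A_def arrows_gpd_fix by auto
    \<comment> \<open>Within the arrows, \<open>A\<close> is the full preimage of the fixed points
      under \<open>src\<close>. Cutting \<open>U\<close> down to \<open>A\<close> therefore cuts its
      image down to exactly the fixed points in it, and the local homeomorphism restricts.\<close>
    have img: "src G ` (U \<inter> A) = src G ` U \<inter> fixed_points G"
      using A_iff by blast
    obtain T where T: "openin (gtop G) T" "src G ` U = T \<inter> unit_space G"
      using U(3) unfolding openin_subtopology by blast
    have "src G ` (U \<inter> A) = (T \<inter> A) \<inter> fixed_points G"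
      using img T(2) fixed_points_subset[of G] A(2) by blast
    then have open_img: "openin (subtopology (subtopology (gtop G) A) (fixed_points G)) (src G ` (U \<inter> A))"
      using T(1) by (auto simp: openin_subtopology)
    have "homeomorphic_map (subtopology (subtopology (gtop G) U) A)
        (subtopology (subtopology (subtopology (gtop G) (unit_space G)) (src G ` U)) (fixed_points G)) (src G)"
    proof (rule homeomorphic_map_subtopologies[OF homeo])
      have "src G ` U \<subseteq> arrows G" "src G ` U \<subseteq> unit_space G"
        using openin_subset[OF U(3)] by auto
      then show "src G ` (topspace (subtopology (gtop G) U) \<inter> A) =
          topspace (subtopology (subtopology (gtop G) (unit_space G)) (src G ` U)) \<inter> fixed_points G"
        using img Uar by (simp add: Int_absorb1 Int_absorb2)
    qed
    moreover have "subtopology (subtopology (gtop G) U) A = subtopology (subtopology (gtop G) A) (U \<inter> A)"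
      by (simp add: subtopology_subtopology Int_ac)
    moreover have "subtopology (subtopology (subtopology (gtop G) (unit_space G)) (src G ` U)) (fixed_points G) =
        subtopology (subtopology (subtopology (gtop G) A) (fixed_points G)) (src G ` (U \<inter> A))"
      unfolding subtopology_subtopology img using A(2) fixed_points_subset[of G]
      by (intro arg_cong[where f = "subtopology (gtop G)"]) blast
    ultimately have "homeomorphic_map (subtopology (subtopology (gtop G) A) (U \<inter> A))
        (subtopology (subtopology (subtopology (gtop G) A) (fixed_points G)) (src G ` (U \<inter> A))) (src G)"
      by simp
    moreover have "openin (subtopology (gtop G) A) (U \<inter> A)"
      using U(1) by (rule openin_subtopology_Int)
    ultimately show "\<exists>U. openin (gtop (gpd_fix G)) U \<and> \<alpha> \<in> U \<and>
        openin (subtopology (gtop (gpd_fix G)) (fixed_points G)) (src (gpd_fix G) ` U) \<and>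
        homeomorphic_map (subtopology (gtop (gpd_fix G)) U)
          (subtopology (subtopology (gtop (gpd_fix G)) (fixed_points G)) (src (gpd_fix G) ` U)) (src (gpd_fix G))"
      unfolding top gpd_fix_simps(2) using U(2) \<alpha>(1) open_img by blast
  qed
  ultimately show ?thesis
    unfolding etale_groupoid_def topological_groupoid_def unit_space_gpd_fix[OF grp]
    using fix_grp by blast
qed

section \<open>Fixed characters as fixed points\<close>

context inverse_sgrp
begin

text \<open>Turns the condition on single values into invariance under the partial action, the form
  that can be compared with \<open>tgt_germ\<close>.\<close>

lemma fixed_characters_iff:
  "\<xi> \<in> fixed_characters S \<longleftrightarrow>
    \<xi> \<in> characters S \<and> (\<forall>s\<in>carrier S. \<xi> \<in> dom s \<longrightarrow> char_act S s \<xi> = \<xi>)"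
proof (intro iffI conjI ballI impI)
  assume \<xi>: "\<xi> \<in> fixed_characters S"
  then show c: "\<xi> \<in> characters S" by (simp add: fixed_characters_def)
  fix s assume s: "s \<in> carrier S" "\<xi> \<in> dom s"
  have "\<xi> (star S s \<cdot> e \<cdot> s) = \<xi> e" if "e \<in> idem S" for e
    using \<xi> that s domD(2)[OF s(2)] unfolding fixed_characters_def by blast
  then show "char_act S s \<xi> = \<xi>"
    using s by (intro char_eqI char_act_characters c) (simp_all add: char_act_apply)
next
  assume *: "\<xi> \<in> characters S \<and> (\<forall>s\<in>carrier S. \<xi> \<in> dom s \<longrightarrow> char_act S s \<xi> = \<xi>)"
  have "\<xi> (star S s \<cdot> e \<cdot> s) = \<xi> e"
    if "e \<in> idem S" "s \<in> carrier S" "\<xi> (star S s \<cdot> s) = 1" for e s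
  proof -
    have "char_act S s \<xi> = \<xi>" using * that by (simp add: char_dom_iff)
    from fun_cong[OF this, of e] show ?thesis using that by (simp add: char_act_apply)
  qed
  then show "\<xi> \<in> fixed_characters S"
    using * unfolding fixed_characters_def by blast
qed

lemma fixed_charactersD:
  assumes "\<xi> \<in> fixed_characters S"
  shows "\<xi> \<in> characters S" "\<And>s. s \<in> carrier S \<Longrightarrow> \<xi> \<in> dom s \<Longrightarrow> char_act S s \<xi> = \<xi>"
  using assms fixed_characters_iff by blast+

text \<open>If \<xi> is 1 at \<open>s\<^sup>* s\<close>, this is invariance under \<open>s\<close>.
  If \<xi> is 0 there, it also vanishes at \<open>s\<^sup>* e s\<close>, which lies below
  \<open>s\<^sup>* s\<close>. Having no premise on the value at \<open>s\<^sup>* s\<close>, the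
  identity applies to all fixed characters at once.\<close>

lemma fixed_character_conj:
  assumes \<xi>: "\<xi> \<in> fixed_characters S" and s: "s \<in> carrier S" and e: "e \<in> idem S"
  shows "\<xi> (star S s \<cdot> (e \<cdot> s)) = \<xi> (star S s \<cdot> s) * \<xi> e"
proof (cases "\<xi> (star S s \<cdot> s) = 1")
  case True
  then have "\<xi> \<in> dom s" using fixed_charactersD(1)[OF \<xi>] by (simp add: char_dom_iff)
  from fixed_charactersD(2)[OF \<xi> s this] have "char_act S s \<xi> e = \<xi> e" by simp
  then show ?thesis using True s e by (simp add: char_act_apply)
next
  case False
  note \<xi>' = fixed_charactersD(1)[OF \<xi>]
  have 0: "\<xi> (star S s \<cdot> s) = 0"
    using False char_zero_or_one[OF \<xi>' star_mult_idem[OF s]] by blast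
  have "star S s \<cdot> (e \<cdot> s) = (star S s \<cdot> (e \<cdot> s)) \<cdot> (star S s \<cdot> s)" using s e by simp
  then have "\<xi> (star S s \<cdot> (e \<cdot> s)) = \<xi> (star S s \<cdot> (e \<cdot> s)) * \<xi> (star S s \<cdot> s)"
    using char_mult[OF \<xi>' conj_idem[OF s e] star_mult_idem[OF s]] by simp
  then show ?thesis using 0 by simp
qed

text \<open>The case of \<open>fixed_character_conj\<close> in which \<open>e\<close> is the domain
  idempotent of \<open>s\<close>. It makes the value at the domain idempotent multiplicative, which
  is what compatibility of \<open>nu_Clif\<close> with products requires of the first half of its
  definition.\<close>

lemma fixed_character_dom_mult:
  assumes "\<xi> \<in> fixed_characters S" "s \<in> carrier S" "t \<in> carrier S"
  shows "\<xi> (star S (s \<cdot> t) \<cdot> (s \<cdot> t)) = \<xi> (star S s \<cdot> s) * \<xi> (star S t \<cdot> t)"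
  using fixed_character_conj[OF assms(1,3) star_mult_idem[OF assms(2)]] assms by (simp add: star_mult)

lemma fixed_points_universal_groupoid: "fixed_points G = unit_germ S ` fixed_characters S"
proof (intro equalityI subsetI)
  fix x assume x: "x \<in> fixed_points G"
  then obtain \<xi> where \<xi>: "\<xi> \<in> characters S" "x = unit_germ S \<xi>"
    using fixed_points_subset[of G] unfolding unit_space_universal_groupoid by blast
  have "char_act S s \<xi> = \<xi>" if s: "s \<in> carrier S" "\<xi> \<in> dom s" for s
  proof -
    have "tgt G (germ S s \<xi>) = src G (germ S s \<xi>)"
      using fixed_points_tgt[OF germ_in_arrows[OF s]] src_germ[OF s] x \<xi> by simp
    then show ?thesis
      unfolding src_germ[OF s] tgt_germ[OF s]
      using unit_germ_inject char_act_characters[OF s] \<xi>(1) by blast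
  qed
  then show "x \<in> unit_germ S ` fixed_characters S"
    using \<xi> fixed_characters_iff by blast
next
  fix x assume "x \<in> unit_germ S ` fixed_characters S"
  then obtain \<xi> where \<xi>: "\<xi> \<in> fixed_characters S" "x = unit_germ S \<xi>" by blast
  note \<xi>' = fixed_charactersD(1)[OF \<xi>(1)]
  have "tgt G \<alpha> = x" if \<alpha>: "\<alpha> \<in> arrows G" "src G \<alpha> = x" for \<alpha>
  proof -
    obtain s \<eta> where s: "s \<in> carrier S" "\<eta> \<in> dom s" "\<alpha> = germ S s \<eta>"
      using arrowE[OF \<alpha>(1)] .
    then have "\<eta> = \<xi>"
      using \<alpha>(2) \<xi>(2) src_germ[OF s(1,2)] unit_germ_inject[OF domD(1)[OF s(2)] \<xi>'] by simp
    then show ?thesis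
      using s tgt_germ[OF s(1,2)] fixed_charactersD(2)[OF \<xi>(1) s(1)] \<xi>(2) by simp
  qed
  then show "x \<in> fixed_points G"
    using \<xi> \<xi>' unfolding fixed_points_def unit_space_universal_groupoid by blast
qed

lemma germ_in_gpd_fix_iff:
  assumes "s \<in> carrier S" "\<xi> \<in> dom s"
  shows "germ S s \<xi> \<in> arrows (gpd_fix G) \<longleftrightarrow> \<xi> \<in> fixed_characters S"
proof -
  have "germ S s \<xi> \<in> arrows (gpd_fix G) \<longleftrightarrow> unit_germ S \<xi> \<in> unit_germ S ` fixed_characters S"
    unfolding arrows_gpd_fix fixed_points_universal_groupoid
    using germ_in_arrows[OF assms] src_germ[OF assms] by simp
  also have "\<dots> \<longleftrightarrow> \<xi> \<in> fixed_characters S"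
    using unit_germ_inject[OF domD(1)[OF assms(2)]] fixed_charactersD(1) by blast
  finally show ?thesis .
qed

subsection \<open>The quotient by \<open>\<nu>\<^sub>C\<^sub>l\<^sub>i\<^sub>f\<close>\<close>

abbreviation cls :: "'a \<Rightarrow> 'a set" where
  "cls s \<equiv> nu_Clif S `` {s}"

lemma nu_Clif_iff:
  "(s, t) \<in> nu_Clif S \<longleftrightarrow> s \<in> carrier S \<and> t \<in> carrier S \<and>
     (\<forall>\<xi>\<in>fixed_characters S. \<xi> (star S s \<cdot> s) = \<xi> (star S t \<cdot> t)) \<and>
     (\<exists>e\<in>idem S. (\<forall>\<xi>\<in>fixed_characters S. \<xi> e = \<xi> (star S s \<cdot> s)) \<and> s \<cdot> e = t \<cdot> e)"
  unfolding nu_Clif_def rho_Clif_def by auto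

lemma nu_ClifI:
  assumes "s \<in> carrier S" "t \<in> carrier S" "e \<in> idem S" "s \<cdot> e = t \<cdot> e"
    and "\<And>\<xi>. \<xi> \<in> fixed_characters S \<Longrightarrow> \<xi> (star S s \<cdot> s) = \<xi> (star S t \<cdot> t)"
    and "\<And>\<xi>. \<xi> \<in> fixed_characters S \<Longrightarrow> \<xi> e = \<xi> (star S s \<cdot> s)"
  shows "(s, t) \<in> nu_Clif S"
  unfolding nu_Clif_iff using assms by blast

lemma fixed_character_square:
  "\<xi> \<in> fixed_characters S \<Longrightarrow> e \<in> idem S \<Longrightarrow> \<xi> e * \<xi> e = \<xi> e"
  by (metis char_mult fixed_charactersD(1) idem_idem)

lemma equiv_nu_Clif: "equiv (carrier S) (nu_Clif S)"
proof (rule equivI)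
  show "nu_Clif S \<subseteq> carrier S \<times> carrier S"
    unfolding nu_Clif_def by blast
  show "refl_on (carrier S) (nu_Clif S)"
    by (rule refl_onI, rule nu_ClifI[OF _ _ star_mult_idem]) simp_all
  show "sym (nu_Clif S)"
    by (rule symI) (unfold nu_Clif_iff, metis)
  show "trans (nu_Clif S)"
  proof (rule transI)
    fix s t u assume st: "(s, t) \<in> nu_Clif S" and tu: "(t, u) \<in> nu_Clif S"
    obtain e where e: "e \<in> idem S" "\<forall>\<xi>\<in>fixed_characters S. \<xi> e = \<xi> (star S s \<cdot> s)" "s \<cdot> e = t \<cdot> e"
      using st unfolding nu_Clif_iff by blast
    obtain f where f: "f \<in> idem S" "\<forall>\<xi>\<in>fixed_characters S. \<xi> f = \<xi> (star S t \<cdot> t)" "t \<cdot> f = u \<cdot> f"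
      using tu unfolding nu_Clif_iff by blast
    have c: "s \<in> carrier S" "t \<in> carrier S" "u \<in> carrier S"
      using st tu unfolding nu_Clif_iff by blast+
    have eq: "\<xi> (star S s \<cdot> s) = \<xi> (star S t \<cdot> t)" "\<xi> (star S t \<cdot> t) = \<xi> (star S u \<cdot> u)"
      if "\<xi> \<in> fixed_characters S" for \<xi>
      using st tu that unfolding nu_Clif_iff by blast+
    show "(s, u) \<in> nu_Clif S"
    proof (rule nu_ClifI)
      show "s \<cdot> (e \<cdot> f) = u \<cdot> (e \<cdot> f)"
        using mult_assoc[of s e f] mult_assoc[of t e f] mult_assoc[of t f e] mult_assoc[of u f e]
          idem_commute[OF e(1) f(1)] c e f by simp
      fix \<xi> assume \<xi>: "\<xi> \<in> fixed_characters S"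
      have "\<xi> (e \<cdot> f) = \<xi> (star S t \<cdot> t) * \<xi> (star S t \<cdot> t)"
        using char_mult[OF fixed_charactersD(1)[OF \<xi>] e(1) f(1)] e f \<xi> eq[OF \<xi>] by metis
      also have "\<dots> = \<xi> (star S s \<cdot> s)"
        using fixed_character_square[OF \<xi> star_mult_idem[OF c(2)]] eq[OF \<xi>] by simp
      finally show "\<xi> (e \<cdot> f) = \<xi> (star S s \<cdot> s)" .
      show "\<xi> (star S s \<cdot> s) = \<xi> (star S u \<cdot> u)" using eq[OF \<xi>] by simp
    qed (use c e f in auto)
  qed
qed

lemma nu_Clif_mult:
  assumes st: "(s, t) \<in> nu_Clif S" and uv: "(u, v) \<in> nu_Clif S"
  shows "(s \<cdot> u, t \<cdot> v) \<in> nu_Clif S"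
proof -
  obtain e where e: "e \<in> idem S" "\<forall>\<xi>\<in>fixed_characters S. \<xi> e = \<xi> (star S s \<cdot> s)" "s \<cdot> e = t \<cdot> e"
    using st unfolding nu_Clif_iff by blast
  obtain f where f: "f \<in> idem S" "\<forall>\<xi>\<in>fixed_characters S. \<xi> f = \<xi> (star S u \<cdot> u)" "u \<cdot> f = v \<cdot> f"
    using uv unfolding nu_Clif_iff by blast
  have c: "s \<in> carrier S" "t \<in> carrier S" "u \<in> carrier S" "v \<in> carrier S"
    using st uv unfolding nu_Clif_iff by blast+
  have eq: "\<xi> (star S s \<cdot> s) = \<xi> (star S t \<cdot> t)" "\<xi> (star S u \<cdot> u) = \<xi> (star S v \<cdot> v)"
    if "\<xi> \<in> fixed_characters S" for \<xi>
    using st uv that unfolding nu_Clif_iff by blast+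
  \<comment> \<open>The witness \<open>e\<close> for \<open>s\<close> and \<open>t\<close> is needed
    to the left of \<open>u\<close>; conjugation moves it to the right, \<open>u h = e u\<close>. On
    \<open>h f\<close> both \<open>u\<close> and \<open>v\<close> give \<open>e u f\<close>, and
    there \<open>s\<close> and \<open>t\<close> agree.\<close>
  define h where "h = star S u \<cdot> (e \<cdot> u)"
  have h: "h \<in> idem S" "u \<cdot> h = e \<cdot> u" using c e mult_idem_eq unfolding h_def by simp_all
  show ?thesis
  proof (rule nu_ClifI)
    have "v \<cdot> (h \<cdot> f) = u \<cdot> (h \<cdot> f)"
      using c f h(1) mult_assoc[of v f h] mult_assoc[of u f h] idem_commute[OF h(1) f(1)] by simp
    also have "\<dots> = e \<cdot> u \<cdot> f"
      using c e f h mult_assoc[of u h f] by simp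
    finally have v: "v \<cdot> (h \<cdot> f) = e \<cdot> u \<cdot> f" and u: "u \<cdot> (h \<cdot> f) = e \<cdot> u \<cdot> f"
      using c e f h mult_assoc[of u h f] by simp_all
    have "t \<cdot> (e \<cdot> u \<cdot> f) = s \<cdot> (e \<cdot> u \<cdot> f)"
      using c e f mult_assoc[of s e "u \<cdot> f"] mult_assoc[of t e "u \<cdot> f"] by simp
    then show "s \<cdot> u \<cdot> (h \<cdot> f) = t \<cdot> v \<cdot> (h \<cdot> f)"
      using c e f h u v by simp
    fix \<xi> assume \<xi>: "\<xi> \<in> fixed_characters S"
    show "\<xi> (star S (s \<cdot> u) \<cdot> (s \<cdot> u)) = \<xi> (star S (t \<cdot> v) \<cdot> (t \<cdot> v))"
      using c eq[OF \<xi>] by (simp only: fixed_character_dom_mult[OF \<xi>])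
    have "\<xi> (h \<cdot> f) = \<xi> h * \<xi> f"
      using char_mult[OF fixed_charactersD(1)[OF \<xi>]] h f by blast
    also have "\<dots> = \<xi> (star S u \<cdot> u) * \<xi> e * \<xi> (star S u \<cdot> u)"
      using fixed_character_conj[OF \<xi> c(3) e(1)] f \<xi> by (simp add: h_def)
    also have "\<dots> = \<xi> (star S s \<cdot> s) * (\<xi> (star S u \<cdot> u) * \<xi> (star S u \<cdot> u))"
      using e \<xi> by simp
    also have "\<dots> = \<xi> (star S (s \<cdot> u) \<cdot> (s \<cdot> u))"
      unfolding fixed_character_square[OF \<xi> star_mult_idem[OF c(3)]]
        fixed_character_dom_mult[OF \<xi> c(1,3)] ..
    finally show "\<xi> (h \<cdot> f) = \<xi> (star S (s \<cdot> u) \<cdot> (s \<cdot> u))" .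
  qed (use c f h in auto)
qed

lemma cls_eq_iff:
  "s \<in> carrier S \<Longrightarrow> t \<in> carrier S \<Longrightarrow> cls s = cls t \<longleftrightarrow> (s, t) \<in> nu_Clif S"
  using eq_equiv_class_iff[OF equiv_nu_Clif] .

lemma carrier_Clif: "carrier (Clif S) = cls ` carrier S"
  unfolding Clif_def quotient_def by auto

lemma cls_in_carrier: "s \<in> carrier S \<Longrightarrow> cls s \<in> carrier (Clif S)"
  unfolding carrier_Clif by (rule imageI)

lemma cls_self: "s \<in> carrier S \<Longrightarrow> s \<in> cls s"
  using equiv_class_self[OF equiv_nu_Clif] .

lemma mult_Clif:
  assumes "s \<in> carrier S" "t \<in> carrier S"
  shows "cls s \<cdot>\<^bsub>Clif S\<^esub> cls t = cls (s \<cdot> t)"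
proof -
  have "cls (a \<cdot> b) = cls (s \<cdot> t)" if "a \<in> cls s" "b \<in> cls t" for a b
    using that nu_Clif_mult[of s a t b] equiv_class_eq[OF equiv_nu_Clif] by blast
  then have "(\<Union>a\<in>cls s. \<Union>b\<in>cls t. cls (a \<cdot> b)) = cls (s \<cdot> t)"
    using cls_self[OF assms(1)] cls_self[OF assms(2)] by (intro SUP_eq_const) blast+
  then show ?thesis by (simp add: Clif_def)
qed

text \<open>Lallement's lemma: if \<open>x\<close> is an inverse of \<open>s\<^sup>2\<close> and \<open>s\<close> is congruent to \<open>s\<^sup>2\<close>, then \<open>s x s\<close>
  is an idempotent congruent to \<open>s\<close>.\<close>

lemma idem_Clif: "idem (Clif S) = cls ` idem S"
proof (intro equalityI subsetI)
  fix X assume X: "X \<in> idem (Clif S)"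
  then obtain s where s: "s \<in> carrier S" "X = cls s"
    unfolding idem_def carrier_Clif by blast
  with X have "cls (s \<cdot> s) = cls s"
    using mult_Clif[of s s] unfolding idem_def by simp
  then have nu: "(s, s \<cdot> s) \<in> nu_Clif S" using s cls_eq_iff[of s "s \<cdot> s"] by simp
  define x where "x = star S (s \<cdot> s)"
  have x: "x \<in> carrier S" "s \<cdot> s \<cdot> (x \<cdot> (s \<cdot> s)) = s \<cdot> s" "x \<cdot> (s \<cdot> s \<cdot> x) = x"
    using s unfolding x_def by (simp_all del: mult_assoc)
  have "x \<cdot> (s \<cdot> (s \<cdot> (x \<cdot> s))) = x \<cdot> s"
    using x s mult_assoc[of x "s \<cdot> s \<cdot> x" s] by simp
  then have "s \<cdot> (x \<cdot> s) \<in> idem S"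
    using x s by (intro idemI) simp_all
  \<comment> \<open>Replacing both outer factors \<open>s\<close> by the congruent
    \<open>s s\<close> yields \<open>s s x s s\<close>. This equals \<open>s s\<close> because
    \<open>x\<close> is its inverse, and \<open>s s\<close> is congruent to
    \<open>s\<close>.\<close>
  moreover have "(s \<cdot> (x \<cdot> s), s \<cdot> s \<cdot> (x \<cdot> (s \<cdot> s))) \<in> nu_Clif S"
    by (intro nu_Clif_mult nu cls_self[unfolded Image_singleton_iff] x(1))
  ultimately show "X \<in> cls ` idem S"
    using s x nu equiv_class_eq[OF equiv_nu_Clif] by (metis imageI)
next
  fix X assume "X \<in> cls ` idem S"
  then show "X \<in> idem (Clif S)"
    unfolding idem_def[of "Clif S"] using mult_Clif cls_in_carrier by auto
qed

text \<open>The class of \<open>star S s\<close> is an inverse of the class of \<open>s\<close>.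
  Idempotents commute because by \<open>idem_Clif\<close> they have idempotent representatives,
  which commute in \<open>S\<close>.\<close>

theorem inverse_semigroup_Clif: "inverse_semigroup (Clif S)"
proof (rule inverse_semigroupI)
  fix X Y Z
  assume XY: "X \<in> carrier (Clif S)" "Y \<in> carrier (Clif S)"
  then show "X \<cdot>\<^bsub>Clif S\<^esub> Y \<in> carrier (Clif S)"
    unfolding carrier_Clif by (auto simp: mult_Clif)
  assume "Z \<in> carrier (Clif S)"
  with XY show "X \<cdot>\<^bsub>Clif S\<^esub> Y \<cdot>\<^bsub>Clif S\<^esub> Z = X \<cdot>\<^bsub>Clif S\<^esub> (Y \<cdot>\<^bsub>Clif S\<^esub> Z)"
    unfolding carrier_Clif by (auto simp: mult_Clif)
next
  fix X assume "X \<in> carrier (Clif S)"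
  then obtain s where s: "s \<in> carrier S" "X = cls s" unfolding carrier_Clif by blast
  then show "\<exists>Y\<in>carrier (Clif S). X = X \<cdot>\<^bsub>Clif S\<^esub> Y \<cdot>\<^bsub>Clif S\<^esub> X \<and> Y = Y \<cdot>\<^bsub>Clif S\<^esub> X \<cdot>\<^bsub>Clif S\<^esub> Y"
    by (intro bexI[of _ "cls (star S s)"]) (simp_all add: mult_Clif cls_in_carrier)
next
  fix X Y assume "X \<in> idem (Clif S)" "Y \<in> idem (Clif S)"
  then obtain e f where "e \<in> idem S" "f \<in> idem S" "X = cls e" "Y = cls f"
    unfolding idem_Clif by blast
  then show "X \<cdot>\<^bsub>Clif S\<^esub> Y = Y \<cdot>\<^bsub>Clif S\<^esub> X"
    using idem_commute by (simp add: mult_Clif)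
qed

text \<open>Together with \<open>cls_idem_eqD\<close> this says that \<open>nu_Clif\<close>
  restricts to \<open>rho_Clif\<close> on idempotents. The witness is the product
  \<open>e f\<close>: left multiplication by \<open>e\<close> or \<open>f\<close> leaves it
  unchanged, and at a fixed character its value is the common value squared, hence that value
  itself.\<close>

lemma cls_idem_eqI:
  assumes "e \<in> idem S" "f \<in> idem S" "\<And>\<xi>. \<xi> \<in> fixed_characters S \<Longrightarrow> \<xi> e = \<xi> f"
  shows "cls e = cls f"
proof -
  have "(e, f) \<in> nu_Clif S"
  proof (rule nu_ClifI)
    show "e \<cdot> (e \<cdot> f) = f \<cdot> (e \<cdot> f)"
      using assms idem_left_commute[of f e f] by simp
    fix \<xi> assume \<xi>: "\<xi> \<in> fixed_characters S"
    have "\<xi> (e \<cdot> f) = \<xi> e * \<xi> e"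
      using char_mult[OF fixed_charactersD(1)[OF \<xi>] assms(1,2)] assms(3)[OF \<xi>] by simp
    also have "\<dots> = \<xi> (star S e \<cdot> e)"
      using fixed_character_square[OF \<xi> assms(1)] assms(1) by simp
    finally show "\<xi> (e \<cdot> f) = \<xi> (star S e \<cdot> e)" .
  qed (use assms in simp_all)
  then show ?thesis using equiv_class_eq[OF equiv_nu_Clif] by blast
qed

lemma cls_idem_eqD:
  assumes "e \<in> idem S" "f \<in> idem S" "cls e = cls f" "\<xi> \<in> fixed_characters S"
  shows "\<xi> e = \<xi> f"
  using assms cls_eq_iff[of e f] unfolding nu_Clif_iff by auto

end

subsection \<open>The isomorphism\<close>

text \<open>A separate locale with the same assumption: the interpretation for \<open>Clif S\<close>
  then supplies the theory of inverse semigroups for the quotient without forming the quotient of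
  the quotient in turn.\<close>

locale inverse_sgrp_Clif = inverse_sgrp
begin

sublocale C: inverse_sgrp "Clif S"
  by standard (rule inverse_semigroup_Clif)

lemma idem_ClifE:
  assumes "X \<in> idem (Clif S)" obtains e where "e \<in> idem S" "X = cls e"
  using assms unfolding idem_Clif by (rule imageE)

lemma star_Clif: "s \<in> carrier S \<Longrightarrow> star (Clif S) (cls s) = cls (star S s)"
  by (rule C.star_unique) (simp_all add: cls_in_carrier mult_Clif)

lemma cls_idem: "e \<in> idem S \<Longrightarrow> cls e \<in> idem (Clif S)"
  unfolding idem_Clif by (rule imageI)

lemma cls_dom: "s \<in> carrier S \<Longrightarrow> C.dom (cls s) = char_dom (Clif S) (cls (star S s \<cdot> s))"
  by (simp add: star_Clif mult_Clif)

section \<open>Characters of the quotient and fixed characters of \<open>S\<close>\<close>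

definition pull :: "('a set \<Rightarrow> nat) \<Rightarrow> 'a \<Rightarrow> nat" where
  "pull \<xi> = (\<lambda>e\<in>idem S. \<xi> (cls e))"

text \<open>The inverse of \<open>pull\<close>, meaningful for fixed \<eta>: these are constant on
  the idempotents of a class by \<open>cls_idem_eqD\<close>, so the chosen representative does not
  matter.\<close>

definition push :: "('a \<Rightarrow> nat) \<Rightarrow> 'a set \<Rightarrow> nat" where
  "push \<eta> = (\<lambda>X\<in>idem (Clif S). \<eta> (SOME e. e \<in> idem S \<and> cls e = X))"

lemma pull_apply: "e \<in> idem S \<Longrightarrow> pull \<xi> e = \<xi> (cls e)"
  by (simp add: pull_def)

lemma push_apply:
  assumes "\<eta> \<in> fixed_characters S" "e \<in> idem S" shows "push \<eta> (cls e) = \<eta> e"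
proof -
  have "(SOME f. f \<in> idem S \<and> cls f = cls e) \<in> idem S \<and> cls (SOME f. f \<in> idem S \<and> cls f = cls e) = cls e"
    by (rule someI[of _ e]) (use assms in simp)
  then have "\<eta> (SOME f. f \<in> idem S \<and> cls f = cls e) = \<eta> e"
    using cls_idem_eqD assms by blast
  then show ?thesis using cls_idem[OF assms(2)] by (simp add: push_def)
qed

lemma pull_characters:
  assumes \<xi>: "\<xi> \<in> characters (Clif S)" shows "pull \<xi> \<in> characters S"
proof -
  obtain X where "X \<in> idem (Clif S)" "\<xi> X = 1" using C.char_ex_one[OF \<xi>] .
  then obtain e where e: "e \<in> idem S" "\<xi> (cls e) = 1" unfolding idem_Clif by blast
  show ?thesis
  proof (rule charactersI)
    show "pull \<xi> \<in> extensional (idem S)" by (simp add: pull_def)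
    show "e \<in> idem S" "pull \<xi> e = 1" using e by (simp_all add: pull_apply)
    show "pull \<xi> f = 0 \<or> pull \<xi> f = 1" if "f \<in> idem S" for f
      using C.char_zero_or_one[OF \<xi> cls_idem[OF that]] that by (simp add: pull_apply)
    show "pull \<xi> (f \<cdot> g) = pull \<xi> f * pull \<xi> g" if "f \<in> idem S" "g \<in> idem S" for f g
      using that C.char_mult[OF \<xi> cls_idem[OF that(1)] cls_idem[OF that(2)]]
      by (simp add: pull_apply mult_Clif)
  qed
qed

lemma pull_fixed:
  assumes \<xi>: "\<xi> \<in> characters (Clif S)" shows "pull \<xi> \<in> fixed_characters S"
  unfolding fixed_characters_iff
proof (intro conjI ballI impI)
  show c: "pull \<xi> \<in> characters S" using pull_characters[OF \<xi>] .
  fix s assume s: "s \<in> carrier S" "pull \<xi> \<in> dom s"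
  show "char_act S s (pull \<xi>) = pull \<xi>"
  proof (rule char_eqI)
    fix e assume e: "e \<in> idem S"
    \<comment> \<open>Every fixed character takes the same value at both idempotents, so they have
      the same class. Hence a character pulled back from the quotient cannot separate them, although
      it is not yet known to be fixed.\<close>
    have "cls (star S s \<cdot> (e \<cdot> s)) = cls ((star S s \<cdot> s) \<cdot> e)"
    proof (rule cls_idem_eqI)
      fix \<eta> assume \<eta>: "\<eta> \<in> fixed_characters S"
      show "\<eta> (star S s \<cdot> (e \<cdot> s)) = \<eta> (star S s \<cdot> s \<cdot> e)"
        unfolding fixed_character_conj[OF \<eta> s(1) e]
          char_mult[OF fixed_charactersD(1)[OF \<eta>] star_mult_idem[OF s(1)] e] ..
    qed (use s e in blast)+
    then have "pull \<xi> (star S s \<cdot> (e \<cdot> s)) = pull \<xi> ((star S s \<cdot> s) \<cdot> e)"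
      using pull_apply[OF conj_idem[OF s(1) e]] pull_apply[OF idem_mult[OF star_mult_idem[OF s(1)] e]]
      by metis
    also have "\<dots> = pull \<xi> e"
      using char_mult[OF c star_mult_idem[OF s(1)] e] domD(2)[OF s(2)] by simp
    finally show "char_act S s (pull \<xi>) e = pull \<xi> e"
      using s e by (simp add: char_act_apply)
  qed (use s c char_act_characters in blast)+
qed

lemma push_characters:
  assumes \<eta>: "\<eta> \<in> fixed_characters S" shows "push \<eta> \<in> characters (Clif S)"
proof -
  note c = fixed_charactersD(1)[OF \<eta>]
  obtain e where e: "e \<in> idem S" "\<eta> e = 1" using char_ex_one[OF c] .
  show ?thesis
  proof (rule C.charactersI)
    show "push \<eta> \<in> extensional (idem (Clif S))" by (simp add: push_def)
    show "cls e \<in> idem (Clif S)" "push \<eta> (cls e) = 1"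
      using e cls_idem push_apply[OF \<eta>] by simp_all
    show "push \<eta> X = 0 \<or> push \<eta> X = 1" if "X \<in> idem (Clif S)" for X
    proof -
      obtain f where "f \<in> idem S" "X = cls f" using \<open>X \<in> idem (Clif S)\<close> by (rule idem_ClifE)
      then show ?thesis using char_zero_or_one[OF c] push_apply[OF \<eta>] by metis
    qed
    show "push \<eta> (X \<cdot>\<^bsub>Clif S\<^esub> Y) = push \<eta> X * push \<eta> Y"
      if "X \<in> idem (Clif S)" "Y \<in> idem (Clif S)" for X Y
    proof -
      obtain f g where "f \<in> idem S" "X = cls f" "g \<in> idem S" "Y = cls g"
        using \<open>X \<in> idem (Clif S)\<close> \<open>Y \<in> idem (Clif S)\<close> by (elim idem_ClifE)
      then show ?thesis
        using push_apply[OF \<eta>] char_mult[OF c] by (simp add: mult_Clif)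
    qed
  qed
qed

lemma pull_push:
  assumes "\<eta> \<in> fixed_characters S" shows "pull (push \<eta>) = \<eta>"
  by (rule char_eqI[OF pull_characters[OF push_characters[OF assms]] fixed_charactersD(1)[OF assms]])
    (simp add: pull_apply push_apply[OF assms])

lemma push_pull:
  assumes \<xi>: "\<xi> \<in> characters (Clif S)" shows "push (pull \<xi>) = \<xi>"
proof (rule C.char_eqI[OF push_characters[OF pull_fixed[OF \<xi>]] \<xi>])
  fix X assume "X \<in> idem (Clif S)"
  then obtain e where "e \<in> idem S" "X = cls e" by (rule idem_ClifE)
  then show "push (pull \<xi>) X = \<xi> X"
    using push_apply[OF pull_fixed[OF \<xi>]] pull_apply by simp
qed

lemma continuous_map_pull: "continuous_map (character_space (Clif S)) (character_space S) pull"
proof (rule continuous_map_into_character_space)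
  show "pull \<xi> \<in> characters S" if "\<xi> \<in> topspace (character_space (Clif S))" for \<xi>
    using that pull_characters by simp
  fix e assume e: "e \<in> idem S"
  show "continuous_map (character_space (Clif S)) (discrete_topology {0, 1}) (\<lambda>\<xi>. pull \<xi> e)"
    unfolding pull_apply[OF e] by (rule C.continuous_map_character_eval[OF cls_idem[OF e]])
qed

lemma continuous_map_push:
  "continuous_map (subtopology (character_space S) (fixed_characters S)) (character_space (Clif S)) push"
proof (rule C.continuous_map_into_character_space)
  show "push \<eta> \<in> characters (Clif S)"
    if "\<eta> \<in> topspace (subtopology (character_space S) (fixed_characters S))" for \<eta>
    using that push_characters by simp
  fix X assume "X \<in> idem (Clif S)"
  then obtain e where e: "e \<in> idem S" "X = cls e" by (rule idem_ClifE)
  \<comment> \<open>With one representative \<open>e\<close> of \<open>X\<close> held fixed,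
    evaluation of \<open>push \<eta>\<close> at \<open>X\<close> is evaluation of \<eta> at
    \<open>e\<close>. The two agree on fixed characters, which is why the map is considered on that
    subspace.\<close>
  show "continuous_map (subtopology (character_space S) (fixed_characters S)) (discrete_topology {0, 1})
      (\<lambda>\<eta>. push \<eta> X)"
  proof (rule continuous_map_eq)
    show "continuous_map (subtopology (character_space S) (fixed_characters S)) (discrete_topology {0, 1})
      (\<lambda>\<eta>. \<eta> e)"
      by (rule continuous_map_from_subtopology[OF continuous_map_character_eval[OF e(1)]])
  qed (simp add: push_apply e)
qed

lemma dom_pull:
  assumes "s \<in> carrier S" "\<xi> \<in> C.dom (cls s)" shows "pull \<xi> \<in> dom s"
  using assms pull_characters
  unfolding cls_dom[OF assms(1)] C.char_dom_iff char_dom_iff by (simp add: pull_apply)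

lemma dom_push:
  assumes "s \<in> carrier S" "\<eta> \<in> dom s" "\<eta> \<in> fixed_characters S"
  shows "push \<eta> \<in> C.dom (cls s)"
  using assms push_characters push_apply[OF assms(3)]
  unfolding cls_dom[OF assms(1)] C.char_dom_iff char_dom_iff by simp

text \<open>The quotient map respects products and inverses, so conjugating by a class amounts to
  conjugating by any of its representatives.\<close>

lemma pull_char_act:
  assumes "s \<in> carrier S" "\<xi> \<in> C.dom (cls s)"
  shows "pull (char_act (Clif S) (cls s) \<xi>) = char_act S s (pull \<xi>)"
proof (rule char_eqI)
  fix e assume e: "e \<in> idem S"
  have "cls (star S s) \<cdot>\<^bsub>Clif S\<^esub> (cls e \<cdot>\<^bsub>Clif S\<^esub> cls s) = cls (star S s \<cdot> (e \<cdot> s))"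
    using assms e by (simp add: mult_Clif)
  then show "pull (char_act (Clif S) (cls s) \<xi>) e = char_act S s (pull \<xi>) e"
    using assms e C.char_act_apply[OF cls_in_carrier[OF assms(1)] cls_idem[OF e]]
    by (simp add: pull_apply char_act_apply star_Clif)
next
  show "pull (char_act (Clif S) (cls s) \<xi>) \<in> characters S"
    using assms C.char_act_characters cls_in_carrier pull_characters by blast
  show "char_act S s (pull \<xi>) \<in> characters S"
    using assms dom_pull char_act_characters by blast
qed

text \<open>The union is a double one because an arrow of the quotient is a class of pairs whose
  first components are themselves classes. \<open>\<Phi>_germ\<close> shows that all its terms
  agree.\<close>

definition \<Phi> :: "('a set \<times> ('a set \<Rightarrow> nat)) set \<Rightarrow> ('a \<times> ('a \<Rightarrow> nat)) set" where
  "\<Phi> A = (\<Union>(X, \<xi>)\<in>A. \<Union>s\<in>X. germ S s (pull \<xi>))"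

text \<open>One direction gives independence of representatives, the other injectivity of
  \<open>\<Phi>\<close> over a given character.\<close>

lemma germ_cls_eq_iff:
  assumes s: "s \<in> carrier S" "\<xi> \<in> C.dom (cls s)" and t: "t \<in> carrier S" "\<xi> \<in> C.dom (cls t)"
  shows "germ (Clif S) (cls s) \<xi> = germ (Clif S) (cls t) \<xi> \<longleftrightarrow> germ S s (pull \<xi>) = germ S t (pull \<xi>)"
proof
  assume "germ (Clif S) (cls s) \<xi> = germ (Clif S) (cls t) \<xi>"
  then obtain X where "X \<in> idem (Clif S)" "\<xi> X = 1" "cls s \<cdot>\<^bsub>Clif S\<^esub> X = cls t \<cdot>\<^bsub>Clif S\<^esub> X"
    using C.germ_eq_iff[OF cls_in_carrier[OF s(1)] s(2) cls_in_carrier[OF t(1)] t(2)] by blast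
  then obtain e where e: "e \<in> idem S" "\<xi> (cls e) = 1" "cls s \<cdot>\<^bsub>Clif S\<^esub> cls e = cls t \<cdot>\<^bsub>Clif S\<^esub> cls e"
    unfolding idem_Clif by blast
  then have "cls (s \<cdot> e) = cls (t \<cdot> e)"
    using s t by (simp add: mult_Clif)
  then have "(s \<cdot> e, t \<cdot> e) \<in> nu_Clif S"
    using cls_eq_iff[of "s \<cdot> e" "t \<cdot> e"] s t e by simp
  \<comment> \<open>The congruence supplies a second idempotent \<open>f\<close>, equivalent to the
    domain idempotent of \<open>s \<cdot> e\<close>. As \<open>pull \<xi>\<close> is fixed and lies
    in \<open>dom (s \<cdot> e)\<close>, it is 1 at \<open>f\<close>, so \<open>e \<cdot> f\<close>
    witnesses equality of the germs in \<open>S\<close>.\<close>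
  then obtain f where f: "f \<in> idem S" "s \<cdot> e \<cdot> f = t \<cdot> e \<cdot> f"
    "\<forall>\<eta>\<in>fixed_characters S. \<eta> f = \<eta> (star S (s \<cdot> e) \<cdot> (s \<cdot> e))"
    unfolding nu_Clif_iff by blast
  have \<xi>: "\<xi> \<in> characters (Clif S)" using s C.domD(1) by blast
  have e1: "pull \<xi> e = 1" using e by (simp add: pull_apply)
  have "pull \<xi> \<in> dom (s \<cdot> e)"
    using mult_idem_dom(1)[OF s(1) dom_pull[OF s] e(1) e1] .
  then have "pull \<xi> f = 1"
    using f(3) pull_fixed[OF \<xi>] domD(2) by simp
  then have "pull \<xi> (e \<cdot> f) = 1"
    using e1 char_mult[OF pull_characters[OF \<xi>] e(1) f(1)] by simp
  moreover have "s \<cdot> (e \<cdot> f) = t \<cdot> (e \<cdot> f)"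
    using f s t e by simp
  ultimately show "germ S s (pull \<xi>) = germ S t (pull \<xi>)"
    using germ_eqI[OF s(1) dom_pull[OF s] t(1) dom_pull[OF t]] idem_mult[OF e(1) f(1)] by blast
next
  assume "germ S s (pull \<xi>) = germ S t (pull \<xi>)"
  then obtain e where e: "e \<in> idem S" "pull \<xi> e = 1" "s \<cdot> e = t \<cdot> e"
    using germ_eq_iff[OF s(1) dom_pull[OF s] t(1) dom_pull[OF t]] by blast
  have "cls s \<cdot>\<^bsub>Clif S\<^esub> cls e = cls t \<cdot>\<^bsub>Clif S\<^esub> cls e"
    using e s t by (simp add: mult_Clif)
  moreover have "\<xi> (cls e) = 1" using e by (simp add: pull_apply)
  ultimately show "germ (Clif S) (cls s) \<xi> = germ (Clif S) (cls t) \<xi>"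
    using C.germ_eqI[OF cls_in_carrier[OF s(1)] s(2) cls_in_carrier[OF t(1)] t(2) cls_idem[OF e(1)]]
    by blast
qed

lemma \<Phi>_germ:
  assumes s: "s \<in> carrier S" "\<xi> \<in> C.dom (cls s)"
  shows "\<Phi> (germ (Clif S) (cls s) \<xi>) = germ S s (pull \<xi>)"
  unfolding \<Phi>_def
proof (rule C.germ_UN_eq[OF cls_in_carrier[OF s(1)] s(2)])
  fix X \<eta> assume X: "(X, \<eta>) \<in> germ (Clif S) (cls s) \<xi>"
  note X' = C.germD[OF X]
  have eq: "germ (Clif S) X \<xi> = germ (Clif S) (cls s) \<xi>"
    using X' C.germ_eq_iff[OF X'(2,4,3,5)] by simp
  obtain t where t: "t \<in> carrier S" "X = cls t" using X'(3) unfolding carrier_Clif by blast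
  show "(\<Union>u\<in>X. germ S u (pull \<eta>)) = germ S s (pull \<xi>)"
  proof (rule SUP_eq_const)
    show "X \<noteq> {}" using cls_self[OF t(1)] t(2) by blast
    fix u assume "u \<in> X"
    then have u: "u \<in> carrier S" "X = cls u"
      using t equiv_class_eq[OF equiv_nu_Clif] unfolding nu_Clif_def by blast+
    then show "germ S u (pull \<eta>) = germ S s (pull \<xi>)"
      using germ_cls_eq_iff[OF u(1) _ s] X'(1,5) eq by simp
  qed
qed

lemma \<Phi>_unit_germ:
  assumes \<xi>: "\<xi> \<in> characters (Clif S)"
  shows "\<Phi> (unit_germ (Clif S) \<xi>) = unit_germ S (pull \<xi>)"
proof -
  obtain X where X: "X \<in> idem (Clif S)" "\<xi> \<in> C.dom X" "unit_germ (Clif S) \<xi> = germ (Clif S) X \<xi>"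
    using C.unit_germE[OF \<xi>] by blast
  obtain e where e: "e \<in> idem S" "X = cls e" using X(1) by (rule idem_ClifE)
  have "\<Phi> (unit_germ (Clif S) \<xi>) = germ S e (pull \<xi>)"
    using \<Phi>_germ[OF idem_carrier[OF e(1)]] X e by simp
  also have "\<dots> = unit_germ S (pull \<xi>)"
    using unit_germ_eq[OF e(1)] dom_pull[of e \<xi>] X(2) e by simp
  finally show ?thesis .
qed

lemma arrow_ClifE:
  assumes "\<alpha> \<in> arrows C.G"
  obtains s \<xi> where "s \<in> carrier S" "\<xi> \<in> C.dom (cls s)" "\<alpha> = germ (Clif S) (cls s) \<xi>"
proof -
  obtain X \<xi> where "X \<in> carrier (Clif S)" "\<xi> \<in> C.dom X" "\<alpha> = germ (Clif S) X \<xi>"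
    using C.arrowE[OF assms] .
  then show ?thesis using that unfolding carrier_Clif by blast
qed

section \<open>\<open>\<Phi>\<close> as a homeomorphism onto the restriction to the fixed
  points\<close>

lemma \<Phi>_image: "\<Phi> ` arrows C.G = arrows (gpd_fix G)"
proof (intro equalityI subsetI)
  fix \<beta> assume "\<beta> \<in> \<Phi> ` arrows C.G"
  then obtain s \<xi> where s: "s \<in> carrier S" "\<xi> \<in> C.dom (cls s)" "\<beta> = germ S s (pull \<xi>)"
    using \<Phi>_germ by (auto elim: arrow_ClifE)
  then show "\<beta> \<in> arrows (gpd_fix G)"
    using germ_in_gpd_fix_iff[OF s(1) dom_pull] pull_fixed C.domD(1) by blast
next
  fix \<beta> assume \<beta>: "\<beta> \<in> arrows (gpd_fix G)"
  then have "\<beta> \<in> arrows G" by simp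
  then obtain s \<eta> where s: "s \<in> carrier S" "\<eta> \<in> dom s" "\<beta> = germ S s \<eta>"
    by (rule arrowE)
  then have \<eta>: "\<eta> \<in> fixed_characters S" using \<beta> germ_in_gpd_fix_iff by blast
  note p = dom_push[OF s(1,2) \<eta>]
  have "\<Phi> (germ (Clif S) (cls s) (push \<eta>)) = \<beta>"
    using \<Phi>_germ[OF s(1) p] pull_push[OF \<eta>] s(3) by simp
  then show "\<beta> \<in> \<Phi> ` arrows C.G"
    using C.germ_in_arrows[OF cls_in_carrier[OF s(1)] p] by blast
qed

lemma inj_on_\<Phi>: "inj_on \<Phi> (arrows C.G)"
proof (rule inj_onI)
  fix \<alpha> \<beta> assume "\<alpha> \<in> arrows C.G" "\<beta> \<in> arrows C.G" and eq: "\<Phi> \<alpha> = \<Phi> \<beta>"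
  then obtain s \<xi> t \<eta> where s: "s \<in> carrier S" "\<xi> \<in> C.dom (cls s)" "\<alpha> = germ (Clif S) (cls s) \<xi>"
    and t: "t \<in> carrier S" "\<eta> \<in> C.dom (cls t)" "\<beta> = germ (Clif S) (cls t) \<eta>"
    by (metis arrow_ClifE)
  have "germ S s (pull \<xi>) = germ S t (pull \<eta>)"
    using eq \<Phi>_germ s t by metis
  then have "pull \<xi> = pull \<eta>"
    using germ_eq_iff[OF s(1) dom_pull[OF s(1,2)] t(1) dom_pull[OF t(1,2)]] by blast
  \<comment> \<open>Injectivity of \<open>pull\<close> reduces the claim to germs at one and the
    same character, where \<open>germ_cls_eq_iff\<close> decides it.\<close>
  then have "\<xi> = \<eta>"
    using push_pull C.domD(1) s(2) t(2) by metis
  then show "\<alpha> = \<beta>"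
    using germ_cls_eq_iff[OF s(1,2) t(1)] t(2,3) s(3) \<open>germ S s (pull \<xi>) = germ S t (pull \<eta>)\<close> by simp
qed

lemma continuous_map_\<Phi>: "continuous_map (gtop C.G) (gtop (gpd_fix G)) \<Phi>"
proof -
  have "continuous_map (gtop C.G) (gtop G) \<Phi>"
  proof (rule C.continuous_map_from_universal_groupoid)
    show "\<Phi> \<alpha> \<in> arrows G" if "\<alpha> \<in> arrows C.G" for \<alpha>
      using \<Phi>_image that by auto
    fix X V assume "X \<in> carrier (Clif S)" and V: "openin (gtop G) V"
    then obtain s where s: "s \<in> carrier S" "X = cls s" unfolding carrier_Clif by blast
    have "openin (character_space S) {\<eta> \<in> dom s. germ S s \<eta> \<in> V}"
      using V s unfolding openin_universal_groupoid by blast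
    from openin_Int[OF openin_continuous_map_preimage[OF continuous_map_pull this] C.openin_dom[OF cls_in_carrier[OF s(1)]]]
    have "openin (character_space (Clif S))
      ({\<xi> \<in> characters (Clif S). pull \<xi> \<in> {\<eta> \<in> dom s. germ S s \<eta> \<in> V}} \<inter> C.dom (cls s))"
      by (simp only: C.topspace_character_space)
    moreover have "{\<xi> \<in> characters (Clif S). pull \<xi> \<in> {\<eta> \<in> dom s. germ S s \<eta> \<in> V}} \<inter> C.dom (cls s) =
        {\<xi> \<in> C.dom X. \<Phi> (germ (Clif S) X \<xi>) \<in> V}"
      unfolding s(2) using \<Phi>_germ[OF s(1)] dom_pull[OF s(1)] C.domD(1) by auto
    ultimately show "openin (character_space (Clif S)) {\<xi> \<in> C.dom X. \<Phi> (germ (Clif S) X \<xi>) \<in> V}"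
      by simp
  qed
  moreover have "\<Phi> \<in> arrows C.G \<rightarrow> {\<alpha> \<in> arrows G. src G \<alpha> \<in> fixed_points G}"
    using \<Phi>_image unfolding arrows_gpd_fix by blast
  ultimately show ?thesis
    by (simp only: gpd_fix_simps(1) continuous_map_in_subtopology)
qed

lemma open_map_\<Phi>: "open_map (gtop C.G) (gtop (gpd_fix G)) \<Phi>"
  unfolding open_map_def
proof (intro allI impI)
  fix W assume W: "openin (gtop C.G) W"
  show "openin (gtop (gpd_fix G)) (\<Phi> ` W)"
  proof (subst openin_subopen, intro ballI)
    fix \<beta> assume "\<beta> \<in> \<Phi> ` W"
    then obtain \<alpha> where \<alpha>: "\<alpha> \<in> W" "\<alpha> \<in> arrows C.G" "\<beta> = \<Phi> \<alpha>"
      using openin_subset[OF W] by blast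
    then obtain s \<xi> where s: "s \<in> carrier S" "\<xi> \<in> C.dom (cls s)" "\<alpha> = germ (Clif S) (cls s) \<xi>"
      by (metis arrow_ClifE)
    note c = cls_in_carrier[OF s(1)] and \<xi> = C.domD(1)[OF s(2)]
    have "openin (character_space (Clif S)) {\<xi> \<in> C.dom (cls s). germ (Clif S) (cls s) \<xi> \<in> W}"
      using W c unfolding C.openin_universal_groupoid by blast
    from openin_continuous_map_preimage[OF continuous_map_push this]
    obtain V where V: "openin (character_space S) V" and
      eq: "{\<eta> \<in> topspace (subtopology (character_space S) (fixed_characters S)).
        push \<eta> \<in> {\<xi> \<in> C.dom (cls s). germ (Clif S) (cls s) \<xi> \<in> W}} = V \<inter> fixed_characters S"
      unfolding openin_subtopology by blast
    have V_iff: "\<eta> \<in> V \<longleftrightarrow> push \<eta> \<in> C.dom (cls s) \<and> germ (Clif S) (cls s) (push \<eta>) \<in> W"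
      if "\<eta> \<in> fixed_characters S" for \<eta>
      using eq that fixed_charactersD(1)[OF that] by (auto simp: set_eq_iff)
    define N where "N = germ S s ` (V \<inter> dom s) \<inter> arrows (gpd_fix G)"
    have *: "openin (gtop G) (germ S s ` (V \<inter> dom s))"
      using openin_germ_image[OF s(1) openin_Int[OF V openin_dom[OF s(1)]]] by blast
    have N_eq: "N = germ S s ` (V \<inter> dom s) \<inter> {\<alpha> \<in> arrows G. src G \<alpha> \<in> fixed_points G}"
      unfolding N_def arrows_gpd_fix ..
    have "openin (gtop (gpd_fix G)) N"
      unfolding gpd_fix_simps(1) N_eq using * by (rule openin_subtopology_Int)
    moreover have "\<beta> \<in> N"
    proof -
      have "\<beta> = germ S s (pull \<xi>)" using \<Phi>_germ[OF s(1,2)] \<alpha>(3) s(3) by simp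
      moreover have "pull \<xi> \<in> V"
        using V_iff[OF pull_fixed[OF \<xi>]] push_pull[OF \<xi>] s \<alpha>(1) by simp
      ultimately show ?thesis
        using dom_pull[OF s(1,2)] \<Phi>_image \<alpha> unfolding N_def by blast
    qed
    moreover have "N \<subseteq> \<Phi> ` W"
    proof
      fix \<gamma> assume "\<gamma> \<in> N"
      then obtain \<eta> where \<eta>: "\<eta> \<in> V" "\<eta> \<in> dom s" "\<gamma> = germ S s \<eta>" "\<gamma> \<in> arrows (gpd_fix G)"
        unfolding N_def by blast
      then have \<eta>_fix: "\<eta> \<in> fixed_characters S" using germ_in_gpd_fix_iff[OF s(1)] by blast
      have "germ (Clif S) (cls s) (push \<eta>) \<in> W" using V_iff[OF \<eta>_fix] \<eta>(1) by blast
      moreover have "\<gamma> = \<Phi> (germ (Clif S) (cls s) (push \<eta>))"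
        using \<Phi>_germ[OF s(1) dom_push[OF s(1) \<eta>(2) \<eta>_fix]] pull_push[OF \<eta>_fix] \<eta>(3) by simp
      ultimately show "\<gamma> \<in> \<Phi> ` W" by blast
    qed
    ultimately show "\<exists>T. openin (gtop (gpd_fix G)) T \<and> \<beta> \<in> T \<and> T \<subseteq> \<Phi> ` W" by blast
  qed
qed

section \<open>Compatibility of \<open>\<Phi>\<close> with the groupoid operations\<close>

lemma etale_groupoid_iso_\<Phi>: "etale_groupoid_iso C.G (gpd_fix G) \<Phi>"
  unfolding etale_groupoid_iso_def
proof (intro conjI ballI)
  show "homeomorphic_map (gtop C.G) (gtop (gpd_fix G)) \<Phi>"
    by (intro bijective_open_imp_homeomorphic_map continuous_map_\<Phi> open_map_\<Phi> \<Phi>_image inj_on_\<Phi>)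
next
  fix \<alpha> assume "\<alpha> \<in> arrows C.G"
  then obtain s \<xi> where s: "s \<in> carrier S" "\<xi> \<in> C.dom (cls s)" and \<alpha>: "\<alpha> = germ (Clif S) (cls s) \<xi>"
    by (rule arrow_ClifE)
  note c = cls_in_carrier[OF s(1)]
  show "\<Phi> (src C.G \<alpha>) = src (gpd_fix G) (\<Phi> \<alpha>)"
    using C.src_germ[OF c s(2)] \<Phi>_unit_germ[OF C.domD(1)[OF s(2)]] \<Phi>_germ[OF s] src_germ[OF s(1) dom_pull[OF s]]
    by (simp add: \<alpha>)
  show "\<Phi> (tgt C.G \<alpha>) = tgt (gpd_fix G) (\<Phi> \<alpha>)"
    using C.tgt_germ[OF c s(2)] \<Phi>_unit_germ[OF C.char_act_characters[OF c s(2)]] \<Phi>_germ[OF s]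
      tgt_germ[OF s(1) dom_pull[OF s]] pull_char_act[OF s]
    by (simp add: \<alpha>)
  have "char_act (Clif S) (cls s) \<xi> \<in> C.dom (cls (star S s))"
    using C.char_act_dom[OF c s(2)] star_Clif[OF s(1)] by metis
  then show "\<Phi> (ginv C.G \<alpha>) = ginv (gpd_fix G) (\<Phi> \<alpha>)"
    using C.ginv_germ[OF c s(2)] \<Phi>_germ[OF star_closed[OF s(1)]] \<Phi>_germ[OF s] star_Clif[OF s(1)]
      ginv_germ[OF s(1) dom_pull[OF s]] pull_char_act[OF s]
    by (simp add: \<alpha>)
next
  fix p assume "p \<in> composable C.G"
  moreover obtain \<alpha> \<beta> where p: "p = (\<alpha>, \<beta>)" by (cases p)
  ultimately obtain X Y \<xi> where XY: "X \<in> carrier (Clif S)" "Y \<in> carrier (Clif S)" "\<xi> \<in> C.dom Y"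
    "char_act (Clif S) Y \<xi> \<in> C.dom X"
    and \<alpha>\<beta>: "\<alpha> = germ (Clif S) X (char_act (Clif S) Y \<xi>)" "\<beta> = germ (Clif S) Y \<xi>"
    using C.composableE by blast
  then obtain s t where s: "s \<in> carrier S" "X = cls s" and t: "t \<in> carrier S" "Y = cls t"
    unfolding carrier_Clif by blast
  have st: "\<xi> \<in> C.dom (cls (s \<cdot> t))"
    using C.dom_mult[OF XY(1,2)] XY(3,4) mult_Clif[OF s(1) t(1)] s t by metis
  have "\<Phi> (gmult C.G \<alpha> \<beta>) = germ S (s \<cdot> t) (pull \<xi>)"
    using C.gmult_germ[OF XY] mult_Clif[OF s(1) t(1)] \<Phi>_germ[OF mult_closed[OF s(1) t(1)] st] s(2) t(2)
    unfolding \<alpha>\<beta> by simp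
  moreover have "\<Phi> \<alpha> = germ S s (char_act S t (pull \<xi>))" "\<Phi> \<beta> = germ S t (pull \<xi>)"
    using \<Phi>_germ[OF s(1)] \<Phi>_germ[OF t(1)] XY(3,4) pull_char_act[OF t(1)] s(2) t(2) unfolding \<alpha>\<beta> by simp_all
  moreover have "gmult G (germ S s (char_act S t (pull \<xi>))) (germ S t (pull \<xi>)) = germ S (s \<cdot> t) (pull \<xi>)"
  proof (rule gmult_germ[OF s(1) t(1)])
    show "pull \<xi> \<in> dom t" using dom_pull[OF t(1)] XY(3) t(2) by simp
    have "pull (char_act (Clif S) Y \<xi>) \<in> dom s" using dom_pull[OF s(1)] XY(4) s(2) by simp
    then show "char_act S t (pull \<xi>) \<in> dom s" using pull_char_act[OF t(1)] XY(3) t(2) by simp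
  qed
  ultimately show "case p of (\<alpha>, \<beta>) \<Rightarrow> \<Phi> (gmult C.G \<alpha> \<beta>) = gmult (gpd_fix G) (\<Phi> \<alpha>) (\<Phi> \<beta>)"
    by (simp add: p)
qed

end

theorem theorem4p2p2:
  fixes S :: "'a sgrp"
  assumes "inverse_semigroup S"
  shows "etale_groupoid_isomorphic (universal_groupoid (Clif S)) (gpd_fix (universal_groupoid S))"
proof -
  interpret inverse_sgrp_Clif S
    by standard (rule assms)
  show ?thesis
    unfolding etale_groupoid_isomorphic_def
    using C.etale_universal_groupoid etale_gpd_fix[OF etale_universal_groupoid] etale_groupoid_iso_\<Phi>
    by blast
qed

end
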